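(* Let $k\in\mathbb{N}$ and let $\mathcal{A}$ and $\mathcal{C}$ be SD-barriers such that $\operatorname{base}(\mathcal{A})$ is a final segment of $\operatorname{base}(\mathcal{C})$. Then there exists an SD-barrier $\mathcal{B}$ with $\operatorname{base}(\mathcal{B})=\operatorname{base}(\mathcal{A})$ such that $\mathcal{B}\to(\mathcal{A})^{\mathcal{C}}_k$.
   Context: Finite subsets of $\mathbb{N}$ are identified with strictly increasing sequences; $\sqsubseteq$/$\sqsubset$ denote (proper) initial segment; $s^\frown t$ concatenation. A set $\mathcal{B}\subseteq[\mathbb{N}]^{<\omega}$ is a front if either $\mathcal{B}=\{\langle\rangle\}$ (degenerate, base $\mathbb{N}$ by convention) or: (1) $\operatorname{base}(\mathcal{B})=\bigcup_{s\in\mathcal{B}}s$ is infinite; (2) every infinite $X\subseteq\operatorname{base}(\mathcal{B})$ has $s\in\mathcal{B}$ with $s\sqsubset X$; (3) no $s,t\in\mathcal{B}$ with $s\sqsubset t$. Barrier: front with no $s\subsetneq t$ in it. Smooth: for $s,t\in\mathcal{B}$ with $|s|<|t|$ some $i<|s|$ has $s(i)<t(i)$. $T(\mathcal{B})$: finite subsets of $\operatorname{base}(\mathcal{B})$ with no proper initial segment in $\mathcal{B}$ (well-founded tree with leaves $\mathcal{B}$); $\operatorname{ht}_{\mathcal{B}}$ its rank ($0$ on $\mathcal{B}$, else $\sup(\operatorname{ht}_{\mathcal{B}}(s^\frown\langle n\rangle)+1)$), $\operatorname{ht}(\mathcal{B})=\operatorname{ht}_{\mathcal{B}}(\langle\rangle)$.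 $Y$ is a final segment of $X$ if $Y=\{n\in X:n\ge m\}$ for some $m$. If $\operatorname{base}(\mathcal{B})$ is a final segment of $\operatorname{base}(\mathcal{A})$, $\mathcal{A}\oplus\mathcal{B}=\{s^\frown t:s\in\mathcal{B},t\in\mathcal{A},\max s<\min t\}$. A smooth barrier of height $\omega^{\beta_0}+\dots+\omega^{\beta_{n-1}}$ (Cantor normal form) is decomposable if it equals $\mathcal{B}_0\oplus\dots\oplus\mathcal{B}_{n-1}$ for smooth barriers with $\operatorname{ht}(\mathcal{B}_i)=\omega^{\beta_i}$; SD-barrier = smooth decomposable barrier (the degenerate front counts). For a front $\mathcal{C}$: $t$ is $\mathcal{C}$-size if $t\in\mathcal{C}$; $[s]^{\mathcal{C}}=\{u\in\mathcal{C}:u\subseteq s\}$. $\mathbb{1}$ is the barrier of singletons on the relevant base. For fronts with $\operatorname{base}(\mathcal{B})=\operatorname{base}(\mathcal{A})$ a final segment of $\operatorname{base}(\mathcal{C})$, $\mathcal{B}\to(\mathcal{A})^{\mathcal{C}}_k$ means: for every $(\mathbb{1}\oplus\mathcal{B})$-size $s$ and every $c:[s]^{\mathcal{C}}\to\{0,\dots,k-1\}$ there is a $(\mathcal{C}\oplus\mathcal{A})$-size $t\subseteq s$ with $c$ constant on $[t]^{\mathcal{C}}$. *)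

theory Defs
  imports "HOL-Library.Countable_Set" "HOL-Library.FuncSet"
begin

section \<open>Countable ordinals\<close>

text \<open>
  \<open>cardSuc natLeq\<close> is a well-order of type \<open>\<omega>\<^sub>1\<close>; the elements of its field serve as the countable
  ordinals. All ordinal notions below are defined order-theoretically, hence do not depend on
  the representation. Countable ordinals suffice: the trees of finite sets of naturals whose
  ranks are taken are countable.
\<close>

typedef cord = "Field (cardSuc natLeq)"
proof -
  have "infinite (Field (cardSuc natLeq))"
    using natLeq_Cinfinite Cinfinite_cardSuc unfolding cinfinite_def by blast
  then show ?thesis by (metis ex_in_conv finite.emptyI)
qed

lemma cardSuc_natLeq_Well_order: "Well_order (cardSuc natLeq)"
  using cardSuc_Card_order[OF natLeq_Card_order] by (rule card_order_on_well_order_on)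

instantiation cord :: wellorder
begin

definition less_eq_cord :: "cord \<Rightarrow> cord \<Rightarrow> bool"
  where "x \<le> y \<longleftrightarrow> (Rep_cord x, Rep_cord y) \<in> cardSuc natLeq"

definition less_cord :: "cord \<Rightarrow> cord \<Rightarrow> bool"
  where "(x :: cord) < y \<longleftrightarrow> x \<le> y \<and> x \<noteq> y"

instance
proof -
  let ?r = "cardSuc natLeq"
  have lin: "refl_on (Field ?r) ?r" "trans ?r" "antisym ?r" "total_on (Field ?r) ?r"
    and wf: "wf (?r - Id)"
    using cardSuc_natLeq_Well_order
    by (simp_all add: order_on_defs)
  have refl: "x \<le> x" for x :: cord
    using lin(1) Rep_cord unfolding less_eq_cord_def refl_on_def by blast
  have tr: "x \<le> y \<Longrightarrow> y \<le> z \<Longrightarrow> x \<le> z" for x y z :: cord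
    using lin(2) unfolding less_eq_cord_def trans_def by blast
  have asym: "x \<le> y \<Longrightarrow> y \<le> x \<Longrightarrow> x = y" for x y :: cord
    using antisymD[OF lin(3), of "Rep_cord x" "Rep_cord y"] Rep_cord_inject[of x y]
    unfolding less_eq_cord_def by simp
  have tot: "x \<le> y \<or> y \<le> x" for x y :: cord
    using lin(4) Rep_cord[of x] Rep_cord[of y] refl[of x] Rep_cord_inject[of x y]
    unfolding less_eq_cord_def total_on_def by auto
  have ind: "P a" if step: "\<And>x. (\<And>y. y < x \<Longrightarrow> P y) \<Longrightarrow> P x" for P and a :: cord
  proof -
    have "wf (inv_image (?r - Id) Rep_cord)" using wf by (rule wf_inv_image)
    moreover have "inv_image (?r - Id) Rep_cord = {(x, y). x < y}"
      by (auto simp: inv_image_def less_cord_def less_eq_cord_def Rep_cord_inject)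
    ultimately have "wf {(x :: cord, y). x < y}" by simp
    then show ?thesis by (rule wf_induct_rule) (use step in auto)
  qed
  show "OFCLASS(cord, wellorder_class)"
  proof (standard, goal_cases)
    case (1 x y)
    then show ?case using asym[of x y] by (auto simp: less_cord_def)
  next
    case (2 x)
    then show ?case by (rule refl)
  next
    case (3 x y z)
    then show ?case by (rule tr)
  next
    case (4 x y)
    then show ?case by (rule asym)
  next
    case (5 x y)
    then show ?case by (rule tot)
  next
    case (6 P a)
    then show ?case by (rule ind)
  qed
qed

end

lemma countable_atMost_cord:
  includes cardinal_syntax
  shows "countable {..x :: cord}"
proof -
  let ?r = "cardSuc natLeq"
  have "|underS ?r (Rep_cord x)| <o ?r"
    using cardSuc_Card_order[OF natLeq_Card_order] Rep_cord by (rule card_of_underS)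
  then have "|underS ?r (Rep_cord x)| \<le>o natLeq"
    using cardSuc_ordLeq_ordLess[OF natLeq_Card_order card_of_Card_order] by blast
  then have "|underS ?r (Rep_cord x)| \<le>o |UNIV :: nat set|"
    using card_of_nat ordIso_symmetric ordLeq_ordIso_trans by blast
  then have "countable (underS ?r (Rep_cord x))"
    unfolding countable_def card_of_ordLeq[symmetric] by blast
  moreover have "Rep_cord ` {..<x} \<subseteq> underS ?r (Rep_cord x)"
    by (auto simp: underS_def less_cord_def less_eq_cord_def Rep_cord_inject)
  ultimately have "countable (Rep_cord ` {..<x})" by (rule countable_subset[rotated])
  then have "countable {..<x}"
    by (rule countable_image_inj_on) (simp add: inj_on_def Rep_cord_inject)
  moreover have "{..x} = insert x {..<x}" by auto
  ultimately show ?thesis by simp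
qed

lemma uncountable_UNIV_cord:
  includes cardinal_syntax
  shows "\<not> countable (UNIV :: cord set)"
proof
  assume "countable (UNIV :: cord set)"
  then have "countable (Rep_cord ` UNIV)" by (rule countable_image)
  then have "countable (Field (cardSuc natLeq))"
    using type_definition.Rep_range[OF type_definition_cord] by simp
  then have "|Field (cardSuc natLeq)| \<le>o |UNIV :: nat set|"
    unfolding countable_def card_of_ordLeq[symmetric] by blast
  then have "|Field (cardSuc natLeq)| \<le>o natLeq"
    using card_of_nat ordLeq_ordIso_trans by blast
  then have "cardSuc natLeq \<le>o natLeq"
    using card_of_Field_ordIso[OF cardSuc_Card_order[OF natLeq_Card_order]]
      ordIso_symmetric ordIso_ordLeq_trans by blast
  then show False
    using cardSuc_greater[OF natLeq_Card_order] not_ordLess_ordLeq by blast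
qed

lemma countable_bounded_cord:
  assumes "countable (S :: cord set)"
  shows "\<exists>u. \<forall>x\<in>S. x < u"
proof (rule ccontr)
  assume "\<not> ?thesis"
  then have "UNIV = (\<Union>x\<in>S. {..x})" by (auto simp: not_less)
  moreover have "countable (\<Union>x\<in>S. {..x})"
    using assms countable_atMost_cord by blast
  ultimately show False using uncountable_UNIV_cord by simp
qed

definition ord_sup :: "cord set \<Rightarrow> cord"
  where "ord_sup S = (LEAST u. \<forall>x\<in>S. x \<le> u)"

definition ord_succ :: "cord \<Rightarrow> cord"
  where "ord_succ x = (LEAST u. x < u)"

lemma ord_sup_upper:
  assumes "countable S" "x \<in> S"
  shows "x \<le> ord_sup S"
proof -
  have "\<exists>u. \<forall>x\<in>S. x \<le> u"
    using countable_bounded_cord[OF assms(1)] less_imp_le by blast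
  then have "\<forall>x\<in>S. x \<le> ord_sup S" unfolding ord_sup_def by (rule LeastI_ex)
  then show ?thesis using assms(2) by blast
qed

lemma ord_sup_least: "(\<And>x. x \<in> S \<Longrightarrow> x \<le> u) \<Longrightarrow> ord_sup S \<le> u"
  unfolding ord_sup_def by (rule Least_le) blast

lemma less_ord_succ: "x < ord_succ x"
  unfolding ord_succ_def
  by (rule LeastI_ex) (use countable_bounded_cord[of "{x}"] in auto)

lemma ord_succ_le_iff: "ord_succ x \<le> y \<longleftrightarrow> x < y"
  using less_ord_succ[of x] unfolding ord_succ_def
  by (meson Least_le order.strict_trans2)

instantiation cord :: "{zero, one, plus}"
begin

definition zero_cord :: cord
  where "(0 :: cord) = (LEAST x. True)"

definition one_cord :: cord
  where "(1 :: cord) = ord_succ 0"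

function plus_cord :: "cord \<Rightarrow> cord \<Rightarrow> cord"
  where [simp del]: "plus_cord a b = ord_sup (insert a ((\<lambda>c. ord_succ (plus_cord a c)) ` {..<b}))"
  by pat_completeness auto
termination
proof (relation "inv_image {(x, y). x < y} snd")
  show "wf (inv_image {(x :: cord, y). x < y} (snd :: cord \<times> cord \<Rightarrow> cord))"
    by (rule wf_inv_image[OF wf])
qed simp

instance ..

end

function omega_pow :: "cord \<Rightarrow> cord"
  where [simp del]: "omega_pow b =
    ord_sup (insert 1 (\<Union>c\<in>{..<b}. range (\<lambda>n. ((\<lambda>x. x + omega_pow c) ^^ n) 0)))"
  by pat_completeness auto
termination
  by (relation "{(x, y). x < y}") (rule wf, simp)

text \<open>The usual recursion equations for addition and for powers of \<open>\<omega>\<close> hold.\<close>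

lemma zero_le_cord: "0 \<le> (x :: cord)"
  unfolding zero_cord_def by (rule Least_le) simp

lemma lessThan_zero_cord: "{..<0 :: cord} = {}"
  using zero_le_cord leD by auto

lemma countable_lessThan_cord: "countable {..<x :: cord}"
  by (rule countable_subset[OF _ countable_atMost_cord[of x]]) auto

lemma ord_sup_mono: "countable B \<Longrightarrow> (\<And>x. x \<in> A \<Longrightarrow> \<exists>y\<in>B. x \<le> y) \<Longrightarrow> ord_sup A \<le> ord_sup B"
  by (rule ord_sup_least) (meson ord_sup_upper order_trans)

lemma less_ord_succ_iff: "c < ord_succ b \<longleftrightarrow> c \<le> b"
  by (meson leD leI ord_succ_le_iff)

lemma add_zero_cord: "a + 0 = (a :: cord)"
  by (subst plus_cord.simps) (simp add: lessThan_zero_cord ord_sup_def Least_equality)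

lemma add_less_cord: "c < b \<Longrightarrow> a + c < a + (b :: cord)"
  by (subst (2) plus_cord.simps)
    (use countable_lessThan_cord in \<open>auto simp: ord_succ_le_iff[symmetric] intro!: ord_sup_upper\<close>)

lemma add_left_mono_cord: "c \<le> b \<Longrightarrow> a + c \<le> a + (b :: cord)"
  using add_less_cord[of c b a] by (auto simp: le_less)

lemma le_add_cord: "a \<le> a + (b :: cord)"
  using add_left_mono_cord[OF zero_le_cord] by (simp add: add_zero_cord)

lemma add_ord_succ: "a + ord_succ b = ord_succ (a + b)"
proof (rule antisym)
  show "a + ord_succ b \<le> ord_succ (a + b)"
    by (subst plus_cord.simps, rule ord_sup_least)
      (auto simp: less_ord_succ_iff ord_succ_le_iff intro: add_left_mono_cord le_add_cord less_imp_le
        order.strict_trans1 less_ord_succ)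
  show "ord_succ (a + b) \<le> a + ord_succ b"
    by (simp add: ord_succ_le_iff add_less_cord less_ord_succ)
qed

lemma add_limit_cord:
  assumes "b \<noteq> 0" "\<nexists>c. b = ord_succ c"
  shows "a + b = ord_sup ((+) a ` {..<b})"
proof (rule antisym)
  have cnt: "countable ((+) a ` {..<b})" by (simp add: countable_lessThan_cord)
  have "0 < b" using assms(1) zero_le_cord[of b] by simp
  moreover have "ord_succ c < b" if "c < b" for c
    using that assms(2) ord_succ_le_iff[of c b] by (metis order.not_eq_order_implies_strict)
  ultimately show "a + b \<le> ord_sup ((+) a ` {..<b})"
    by (subst plus_cord.simps, intro ord_sup_mono[OF cnt])
      (auto simp flip: add_ord_succ intro: bexI[of _ 0] simp: add_zero_cord)
  show "ord_sup ((+) a ` {..<b}) \<le> a + b"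
    by (rule ord_sup_least) (auto intro: add_left_mono_cord)
qed

abbreviation (input) ord_mult_nat :: "cord \<Rightarrow> nat \<Rightarrow> cord"
  where "ord_mult_nat a n \<equiv> ((\<lambda>x. x + a) ^^ n) 0"

lemma countable_omega_pow:
  "countable (insert 1 (\<Union>c\<in>{..<b}. range (ord_mult_nat (omega_pow c))))"
  by (simp add: countable_lessThan_cord)

lemma zero_add_cord: "0 + a = (a :: cord)"
proof (induction a rule: less_induct)
  case (less a)
  have "(\<lambda>c. ord_succ (0 + c)) ` {..<a} = ord_succ ` {..<a}"
    by (rule image_cong) (auto simp: less)
  then have "0 + a = ord_sup (insert 0 (ord_succ ` {..<a}))"
    by (subst plus_cord.simps) simp
  also have "\<dots> = a"
  proof (rule antisym)
    show "ord_sup (insert 0 (ord_succ ` {..<a})) \<le> a"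
      by (rule ord_sup_least) (auto simp: zero_le_cord ord_succ_le_iff)
    have "ord_succ x \<le> ord_sup (insert 0 (ord_succ ` {..<a}))" if "x < a" for x
      by (rule ord_sup_upper) (use that countable_lessThan_cord in auto)
    then show "a \<le> ord_sup (insert 0 (ord_succ ` {..<a}))"
      by (metis leI less_irrefl ord_succ_le_iff)
  qed
  finally show ?case .
qed

lemma omega_pow_zero: "omega_pow 0 = 1"
  by (subst omega_pow.simps) (simp add: lessThan_zero_cord ord_sup_def Least_equality)

lemma mult_le_omega_pow: "c < b \<Longrightarrow> ord_mult_nat (omega_pow c) n \<le> omega_pow b"
  by (subst (2) omega_pow.simps, rule ord_sup_upper[OF countable_omega_pow]) auto

lemma omega_pow_mono: "c \<le> b \<Longrightarrow> omega_pow c \<le> omega_pow b"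
  using mult_le_omega_pow[of c b 1] by (auto simp: le_less zero_add_cord)

lemma one_le_omega_pow: "1 \<le> omega_pow b"
  by (subst omega_pow.simps, rule ord_sup_upper[OF countable_omega_pow]) auto

lemma omega_pow_succ: "omega_pow (ord_succ b) = ord_sup (range (ord_mult_nat (omega_pow b)))"
proof (rule antisym)
  have cnt: "countable (range (ord_mult_nat (omega_pow b)))" by simp
  have 1: "omega_pow b \<le> ord_sup (range (ord_mult_nat (omega_pow b)))"
    by (rule ord_sup_upper[OF cnt]) (auto intro: range_eqI[of _ _ 1] simp: zero_add_cord)
  show "omega_pow (ord_succ b) \<le> ord_sup (range (ord_mult_nat (omega_pow b)))"
  proof (subst omega_pow.simps, rule ord_sup_least)
    fix x
    assume "x \<in> insert 1 (\<Union>c\<in>{..<ord_succ b}. range (ord_mult_nat (omega_pow c)))"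
    then consider "x = 1" | c n where "c \<le> b" "x = ord_mult_nat (omega_pow c) n"
      by (auto simp: less_ord_succ_iff)
    then show "x \<le> ord_sup (range (ord_mult_nat (omega_pow b)))"
    proof cases
      case 1
      then show ?thesis
        using one_le_omega_pow \<open>omega_pow b \<le> _\<close> by (auto intro: order_trans)
    next
      case (2 c n)
      show ?thesis
      proof (cases "c = b")
        case True
        then show ?thesis using 2 by (auto intro: ord_sup_upper[OF cnt])
      next
        case False
        then have "x \<le> omega_pow b" using 2 mult_le_omega_pow[of c b n] by simp
        then show ?thesis using 1 by (rule order_trans)
      qed
    qed
  qed
  show "ord_sup (range (ord_mult_nat (omega_pow b))) \<le> omega_pow (ord_succ b)"
    by (rule ord_sup_least) (auto intro: mult_le_omega_pow less_ord_succ)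
qed

lemma omega_pow_limit:
  assumes "b \<noteq> 0" "\<nexists>c. b = ord_succ c"
  shows "omega_pow b = ord_sup (omega_pow ` {..<b})"
proof (rule antisym)
  have cnt: "countable (omega_pow ` {..<b})" by (simp add: countable_lessThan_cord)
  have "0 < b" using assms(1) zero_le_cord[of b] by simp
  moreover have "ord_succ c < b" if "c < b" for c
    using that assms(2) ord_succ_le_iff[of c b] by (metis order.not_eq_order_implies_strict)
  ultimately show "omega_pow b \<le> ord_sup (omega_pow ` {..<b})"
    by (subst omega_pow.simps, intro ord_sup_mono[OF cnt])
      (auto intro: one_le_omega_pow mult_le_omega_pow less_ord_succ)
  show "ord_sup (omega_pow ` {..<b}) \<le> omega_pow b"
    by (rule ord_sup_least) (auto intro: omega_pow_mono)
qed


section \<open>Fronts and barriers\<close>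

text \<open>
  Finite and infinite increasing sequences of naturals are represented by their ranges. The
  \<open>i\<close>-th entry of a finite sequence \<open>s\<close> is \<open>sorted_list_of_set s ! i\<close>, and the concatenation of
  \<open>s\<close> and \<open>t\<close>, available when \<open>precedes s t\<close>, is \<open>s \<union> t\<close>.
\<close>

definition initial_seg :: "nat set \<Rightarrow> nat set \<Rightarrow> bool"
  where "initial_seg s t \<longleftrightarrow> s \<subseteq> t \<and> (\<forall>x\<in>s. \<forall>y\<in>t. y < x \<longrightarrow> y \<in> s)"

definition proper_initial_seg :: "nat set \<Rightarrow> nat set \<Rightarrow> bool"
  where "proper_initial_seg s t \<longleftrightarrow> initial_seg s t \<and> s \<noteq> t"

definition precedes :: "nat set \<Rightarrow> nat set \<Rightarrow> bool"
  where "precedes s t \<longleftrightarrow> (\<forall>x\<in>s. \<forall>y\<in>t. x < y)"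

definition final_seg :: "nat set \<Rightarrow> nat set \<Rightarrow> bool"
  where "final_seg Y X \<longleftrightarrow> (\<exists>m. Y = {n \<in> X. m \<le> n})"

text \<open>The degenerate front \<open>{{}}\<close> has base \<open>UNIV\<close> by convention.\<close>

definition base :: "nat set set \<Rightarrow> nat set"
  where "base B = (if B = {{}} then UNIV else \<Union>B)"

definition front :: "nat set set \<Rightarrow> bool"
  where "front B \<longleftrightarrow>
    B = {{}} \<or>
    ((\<forall>s\<in>B. finite s) \<and>
     infinite (base B) \<and>
     (\<forall>X. X \<subseteq> base B \<and> infinite X \<longrightarrow> (\<exists>s\<in>B. proper_initial_seg s X)) \<and>
     (\<forall>s\<in>B. \<forall>t\<in>B. \<not> proper_initial_seg s t))"

definition barrier :: "nat set set \<Rightarrow> bool"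
  where "barrier B \<longleftrightarrow> front B \<and> (\<forall>s\<in>B. \<forall>t\<in>B. \<not> s \<subset> t)"

definition smooth :: "nat set set \<Rightarrow> bool"
  where "smooth B \<longleftrightarrow>
    (\<forall>s\<in>B. \<forall>t\<in>B. card s < card t \<longrightarrow>
      (\<exists>i<card s. sorted_list_of_set s ! i < sorted_list_of_set t ! i))"


section \<open>Height\<close>

definition front_tree :: "nat set set \<Rightarrow> nat set set"
  where "front_tree B =
    {s. finite s \<and> s \<subseteq> base B \<and> (\<forall>u\<in>B. \<not> proper_initial_seg u s)}"

definition extensions :: "nat set set \<Rightarrow> nat set \<Rightarrow> nat set set"
  where "extensions B s = {s \<union> {n} | n. n \<in> base B \<and> precedes s {n} \<and> s \<union> {n} \<in> front_tree B}"

definition tree_rel :: "nat set set \<Rightarrow> (nat set \<times> nat set) set"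
  where "tree_rel B = {(t, s). s \<in> front_tree B - B \<and> t \<in> extensions B s}"

text \<open>
  The rank is defined by well-founded recursion along \<open>tree_rel B\<close>; \<open>wf_tree_rel\<close> and
  \<open>ht_at_eq\<close> below show that this is meaningful for every front.
\<close>

definition ht_at :: "nat set set \<Rightarrow> nat set \<Rightarrow> cord"
  where "ht_at B = wfrec (tree_rel B)
    (\<lambda>h s. if s \<in> B then 0 else ord_sup ((\<lambda>t. ord_succ (h t)) ` extensions B s))"

definition ht :: "nat set set \<Rightarrow> cord"
  where "ht B = ht_at B {}"

lemma wf_tree_rel:
  assumes "front B"
  shows "wf (tree_rel B)"
  unfolding wf_iff_no_infinite_down_chain
proof
  assume "\<exists>f. \<forall>i. (f (Suc i), f i) \<in> tree_rel B"
  then obtain f where f: "\<And>i. (f (Suc i), f i) \<in> tree_rel B" by blast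
  show False
  proof (cases "B = {{}}")
    case True
    have "f (Suc 0) \<in> front_tree B - B" using f[of "Suc 0"] by (auto simp: tree_rel_def)
    then show False using True
      by (auto simp: front_tree_def proper_initial_seg_def initial_seg_def)
  next
    case False
    have T: "f i \<in> front_tree B" for i using f[of i] by (auto simp: tree_rel_def)
    have step: "\<exists>n. f (Suc i) = f i \<union> {n} \<and> precedes (f i) {n}" for i
      using f[of i] by (auto simp: tree_rel_def extensions_def)
    have init1: "initial_seg (f i) (f (Suc i))" for i
      using step[of i] by (auto simp: initial_seg_def precedes_def)
    have init: "initial_seg (f i) (f j)" if "i \<le> j" for i j
      using that
    proof (induction rule: dec_induct)
      case base
      then show ?case by (simp add: initial_seg_def)
    next
      case (step n)
      then show ?case using init1[of n] unfolding initial_seg_def by blast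
    qed
    have fin: "finite (f i)" for i using T[of i] by (simp add: front_tree_def)
    have card: "i \<le> card (f i)" for i
    proof (induction i)
      case (Suc i)
      obtain n where "f (Suc i) = f i \<union> {n}" "n \<notin> f i"
        using step[of i] by (auto simp: precedes_def)
      then show ?case using Suc fin[of i] by simp
    qed simp
    define X where "X = (\<Union>i. f i)"
    have "infinite X"
    proof
      assume "finite X"
      then have "card (f (Suc (card X))) \<le> card X"
        by (rule card_mono) (auto simp: X_def)
      then show False using card[of "Suc (card X)"] by simp
    qed
    moreover have "X \<subseteq> base B" using T by (auto simp: X_def front_tree_def)
    ultimately obtain s where s: "s \<in> B" "proper_initial_seg s X"
      using assms False unfolding front_def by blast
    have "finite s" using assms False s(1) unfolding front_def by blast
    have sub: "f i \<subseteq> f j" if "i \<le> j" for i j using init[OF that] by (simp add: initial_seg_def)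
    have "\<exists>i. s \<subseteq> f i"
    proof -
      have "\<forall>x\<in>s. \<exists>i. x \<in> f i" using s(2)
        by (auto simp: proper_initial_seg_def initial_seg_def X_def)
      then obtain g where g: "\<And>x. x \<in> s \<Longrightarrow> x \<in> f (g x)" by metis
      have "g x \<le> Max (g ` s)" if "x \<in> s" for x
        using \<open>finite s\<close> that by simp
      then show ?thesis using g sub by blast
    qed
    then obtain i where i: "s \<subseteq> f i" by blast
    have "f i \<subset> f (Suc i)" using step[of i] by (auto simp: precedes_def)
    then have "proper_initial_seg s (f (Suc i))"
      using i s(2) by (auto simp: proper_initial_seg_def initial_seg_def X_def)
    then show False using T[of "Suc i"] s(1) by (auto simp: front_tree_def)
  qed
qed

lemma ht_at_eq:
  assumes "front B" "s \<in> front_tree B"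
  shows "ht_at B s =
    (if s \<in> B then 0 else ord_sup ((\<lambda>t. ord_succ (ht_at B t)) ` extensions B s))"
proof (cases "s \<in> B")
  case True
  then show ?thesis
    unfolding ht_at_def by (subst wfrec[OF wf_tree_rel[OF assms(1)]]) simp
next
  case False
  have "cut (ht_at B) (tree_rel B) s t = ht_at B t" if "t \<in> extensions B s" for t
    using that False assms(2) by (simp add: tree_rel_def cut_apply)
  then show ?thesis
    using False unfolding ht_at_def
    by (subst wfrec[OF wf_tree_rel[OF assms(1)]]) (simp cong: image_cong)
qed


section \<open>Decomposable barriers\<close>

text \<open>
  The sum is only meaningful if \<open>final_seg (base B) (base A)\<close>. Note the order: the \<open>B\<close>-part of an
  element of \<open>A \<oplus>\<^sub>f B\<close> comes first, as in ordinal addition of heights.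
\<close>

definition front_sum :: "nat set set \<Rightarrow> nat set set \<Rightarrow> nat set set"  (infixr "\<oplus>\<^sub>f" 65)
  where "A \<oplus>\<^sub>f B = {s \<union> t | s t. s \<in> B \<and> t \<in> A \<and> precedes s t}"

text \<open>
  The list \<open>bs\<close> of exponents is the Cantor normal form of the height. Bases are required to
  shrink along \<open>Bs\<close> so that all partial sums are meaningful. The degenerate front is
  decomposable via the empty lists.
\<close>

definition decomposable :: "nat set set \<Rightarrow> bool"
  where "decomposable B \<longleftrightarrow>
    (\<exists>bs Bs. sorted_wrt (\<ge>) bs \<and> ht B = foldr (+) (map omega_pow bs) 0 \<and>
      list_all2 (\<lambda>D b. barrier D \<and> smooth D \<and> ht D = omega_pow b) Bs bs \<and>
      sorted_wrt (\<lambda>D E. final_seg (base E) (base D)) Bs \<and>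
      B = foldr (\<oplus>\<^sub>f) Bs {{}})"

definition SD_barrier :: "nat set set \<Rightarrow> bool"
  where "SD_barrier B \<longleftrightarrow> barrier B \<and> smooth B \<and> decomposable B"

lemma SD_barrier_degenerate: "SD_barrier {{}}"
proof -
  have "front {{}}" by (simp add: front_def)
  moreover have "{} \<in> front_tree {{}}" by (simp add: front_tree_def proper_initial_seg_def)
  ultimately have "ht {{}} = 0" by (simp add: ht_def ht_at_eq)
  then have "decomposable {{}}"
    unfolding decomposable_def by (intro exI[of _ "[]"]) simp
  then show ?thesis
    using \<open>front {{}}\<close> by (simp add: SD_barrier_def barrier_def smooth_def)
qed


section \<open>The partition relation\<close>

definition singletons :: "nat set \<Rightarrow> nat set set"
  where "singletons X = {{n} | n. n \<in> X}"

definition subsets_in :: "nat set \<Rightarrow> nat set set \<Rightarrow> nat set set"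
  where "subsets_in s C = {u \<in> C. u \<subseteq> s}"

text \<open>
  \<open>arrows B A C k\<close> stands for \<open>B \<rightarrow> (A)\<close> with upper index \<open>C\<close> and lower index \<open>k\<close>. It is meant
  for fronts such that \<open>base B = base A\<close> is a final segment of \<open>base C\<close>.
\<close>

definition arrows :: "nat set set \<Rightarrow> nat set set \<Rightarrow> nat set set \<Rightarrow> nat \<Rightarrow> bool"
  where "arrows B A C k \<longleftrightarrow>
    (\<forall>s \<in> singletons (base B) \<oplus>\<^sub>f B. \<forall>c \<in> subsets_in s C \<rightarrow> {..<k}.
      \<exists>t \<in> C \<oplus>\<^sub>f A. t \<subseteq> s \<and> (\<exists>i. \<forall>u \<in> subsets_in t C. c u = i))"

end

theory Submission
  imports Defs "HOL-Library.Infinite_Set"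
begin

text \<open>
  Call a finite \<open>s\<close> good if every colouring of the \<open>C\<close>-size subsets of \<open>s\<close> has a homogeneous
  \<open>(C \<oplus>\<^sub>f A)\<close>-size subset of \<open>s\<close>. Every infinite subset of the base of \<open>A\<close> has a good initial
  segment, by the Nash-Williams theorem. A smooth barrier all of whose elements are good is obtained
  by closing the bad sets under moving entries to the right, which preserves well-foundedness by
  compactness, and taking the minimal sets outside the closure. To make it decomposable, its height
  is raised to an exact power of \<open>\<omega>\<close>: add to the closed family a canonical family of that height
  \<open>omega_pow b\<close>, the rank of a union being the maximum of the ranks. The barrier is then its own
  decomposition.
\<close>

section \<open>Initial segments\<close>

lemma front_bar:
  assumes "front C" "infinite Z" "Z \<subseteq> base C"
  obtains u where "u \<in> C" "finite u" "initial_seg u Z"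
proof (cases "C = {{}}")
  case True
  then show ?thesis using that by (simp add: initial_seg_def)
next
  case False
  then show ?thesis using assms that unfolding front_def proper_initial_seg_def by metis
qed

lemma front_thin:
  assumes "front C" "u \<in> C" "v \<in> C" "initial_seg u v"
  shows "u = v"
  using assms unfolding front_def proper_initial_seg_def by (cases "C = {{}}") auto

lemma front_finite: "front C \<Longrightarrow> u \<in> C \<Longrightarrow> finite u"
  unfolding front_def by auto

lemma initial_seg_trans:
  assumes "initial_seg u v" "initial_seg v w"
  shows "initial_seg u w"
proof -
  have "u \<subseteq> v" "v \<subseteq> w" using assms by (simp_all add: initial_seg_def)
  moreover have "y \<in> u" if "x \<in> u" "y \<in> w" "y < x" for x y
  proof -
    have "x \<in> v" using that(1) \<open>u \<subseteq> v\<close> by blast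
    then have "y \<in> v" using that assms(2) by (simp add: initial_seg_def)
    then show ?thesis using that assms(1) by (simp add: initial_seg_def)
  qed
  ultimately show ?thesis by (simp add: initial_seg_def)
qed

lemma initial_seg_cases:
  assumes "initial_seg u Z" "initial_seg v Z"
  shows "initial_seg u v \<or> initial_seg v u"
proof (cases "u \<subseteq> v")
  case True
  then show ?thesis using assms unfolding initial_seg_def by blast
next
  case False
  then obtain x where x: "x \<in> u" "x \<notin> v" by blast
  have "y < x" if "y \<in> v" for y
  proof (rule ccontr)
    assume "\<not> y < x"
    then have "x < y" using that x by (metis linorder_neqE_nat)
    then show False using assms that x unfolding initial_seg_def by blast
  qed
  then have "v \<subseteq> u" using assms x unfolding initial_seg_def by blast
  then show ?thesis using assms unfolding initial_seg_def by blast
qed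

lemma initial_seg_precedes:
  assumes "initial_seg u Z"
  shows "precedes u (Z - u)"
  unfolding precedes_def
proof (intro ballI)
  fix x y assume "x \<in> u" "y \<in> Z - u"
  then show "x < y" using assms unfolding initial_seg_def by (cases x y rule: linorder_cases) auto
qed

lemma initial_seg_insert_least:
  assumes "initial_seg u Z" "Z - u \<noteq> {}"
  obtains m where "m \<in> Z - u" "precedes u {m}" "initial_seg (insert m u) Z"
    "\<And>y. y \<in> Z - u \<Longrightarrow> m \<le> y"
proof
  define m where "m = (LEAST m. m \<in> Z - u)"
  show m: "m \<in> Z - u" unfolding m_def by (rule LeastI_ex) (use assms(2) in blast)
  show least: "m \<le> y" if "y \<in> Z - u" for y using that unfolding m_def by (rule Least_le)
  show prec: "precedes u {m}" using initial_seg_precedes[OF assms(1)] m by (auto simp: precedes_def)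
  have "y \<in> u" if "y \<in> Z" "y < m" for y using least[of y] that by auto
  then show "initial_seg (insert m u) Z"
    using m assms(1) unfolding initial_seg_def by auto
qed

lemma initial_seg_range:
  fixes f :: "nat \<Rightarrow> nat"
  assumes "strict_mono f" "finite u" "initial_seg u (range f)"
  obtains i where "u = f ` {..<i}"
proof
  define i where "i = (LEAST i. f i \<notin> u)"
  have "infinite (range f)"
    using assms(1) by (simp add: range_inj_infinite strict_mono_imp_inj_on)
  then have "\<exists>i. f i \<notin> u" using assms(2) by (metis finite_subset image_subsetI)
  then have i: "f i \<notin> u" unfolding i_def by (rule LeastI_ex)
  have less: "f j \<in> u" if "j < i" for j using that not_less_Least unfolding i_def by blast
  show "u = f ` {..<i}"
  proof
    show "f ` {..<i} \<subseteq> u" using less by auto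
    show "u \<subseteq> f ` {..<i}"
    proof
      fix x assume x: "x \<in> u"
      then obtain j where j: "x = f j" using assms(3) unfolding initial_seg_def by blast
      have "j < i"
      proof (rule ccontr)
        assume "\<not> j < i"
        then have "f i < f j"
          using i x j assms(1) by (metis linorder_neqE_nat strict_mono_less)
        then show False using assms(3) x j i unfolding initial_seg_def by blast
      qed
      then show "x \<in> f ` {..<i}" using j by simp
    qed
  qed
qed

section \<open>The Nash-Williams theorem\<close>

text \<open>If \<open>P {}\<close> failed, \<open>step\<close> would supply a failing one-point
  extension of every failing set. Dependent choice strings these points into an increasing sequence
  all of whose initial segments fail \<open>P\<close>, against \<open>bar\<close>. Used for
  homogeneous sets and for the existence of ranks.\<close>

lemma bar_induct:
  assumes bar: "\<And>f :: nat \<Rightarrow> nat. strict_mono f \<Longrightarrow> range f \<subseteq> X \<Longrightarrow> \<exists>i. P (f ` {..<i})"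
    and step: "\<And>s. finite s \<Longrightarrow> s \<subseteq> X \<Longrightarrow>
      (\<And>n. n \<in> X \<Longrightarrow> precedes s {n} \<Longrightarrow> P (insert n s)) \<Longrightarrow> P s"
  shows "P {}"
proof (rule ccontr)
  assume neg: "\<not> P {}"
  let ?Q = "\<lambda>s. finite s \<and> s \<subseteq> X \<and> \<not> P s"
  let ?R = "\<lambda>s s'. \<exists>n. n \<in> X \<and> precedes s {n} \<and> s' = insert n s"
  have "\<exists>s. \<forall>i. (?Q (s i) \<and> (i = 0 \<longrightarrow> s i = {})) \<and> ?R (s i) (s (Suc i))"
  proof (rule dependent_nat_choice)
    show "\<exists>s. ?Q s \<and> ((0::nat) = 0 \<longrightarrow> s = {})" using neg by blast
  next
    fix s and i :: nat
    assume s: "?Q s \<and> (i = 0 \<longrightarrow> s = {})"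
    then obtain n where "n \<in> X" "precedes s {n}" "\<not> P (insert n s)" using step by blast
    then show "\<exists>s'. (?Q s' \<and> (Suc i = 0 \<longrightarrow> s' = {})) \<and> ?R s s'"
      using s by (intro exI[of _ "insert n s"]) auto
  qed
  then obtain s
    where "\<forall>i. (?Q (s i) \<and> (i = 0 \<longrightarrow> s i = {})) \<and> ?R (s i) (s (Suc i))" by (rule exE)
  then have s: "\<And>i. ?Q (s i)" "s 0 = {}" "\<And>i. ?R (s i) (s (Suc i))" by simp_all
  from s(3) obtain f
    where f: "\<And>i. f i \<in> X \<and> precedes (s i) {f i} \<and> s (Suc i) = insert (f i) (s i)" by metis
  have "strict_mono f"
    unfolding strict_mono_Suc_iff using f by (metis insertI1 precedes_def singletonI)
  moreover have img: "s i = f ` {..<i}" for i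
    by (induction i) (use s(2) f in \<open>auto simp: lessThan_Suc\<close>)
  moreover have "range f \<subseteq> X" using f by auto
  ultimately obtain i where "P (f ` {..<i})" using bar[of f] by metis
  moreover have "\<not> P (f ` {..<i})" using s(1)[of i] unfolding img by simp
  ultimately show False by simp
qed

text \<open>Fusion: each entry is picked from the current infinite set, which is then cut down to
  larger numbers and thinned out to satisfy \<open>R\<close>. The sets decrease, so all entries
  after \<open>f i\<close> lie in \<open>H i\<close>.\<close>

lemma diagonal_sequence:
  assumes "infinite (Y :: nat set)"
    and thin_out: "\<And>n H. n \<in> Y \<Longrightarrow> infinite H \<Longrightarrow> H \<subseteq> Y \<Longrightarrow> \<exists>H'. infinite H' \<and> H' \<subseteq> H \<and> R n H'"
  shows "\<exists>(f :: nat \<Rightarrow> nat) H. strict_mono f \<and> range f \<subseteq> Y \<and> (\<forall>i. R (f i) (H i)) \<and>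
    (\<forall>i j. i < j \<longrightarrow> f j \<in> (H i :: nat set))"
proof -
  let ?Q = "\<lambda>p. fst p \<in> Y \<and> infinite (snd p) \<and> snd p \<subseteq> Y \<and> R (fst p) (snd p)
    \<and> (\<forall>x\<in>snd p. fst p < x)"
  have ex: "\<exists>p. ?Q p \<and> fst p \<in> H \<and> snd p \<subseteq> H" if H: "infinite H" "H \<subseteq> Y" for H
  proof -
    obtain n where n: "n \<in> H" using H by (metis ex_in_conv finite.emptyI)
    have "infinite {x \<in> H. n < x}"
    proof
      assume "finite {x \<in> H. n < x}"
      moreover have "H \<subseteq> {x \<in> H. n < x} \<union> {..n}" by auto
      ultimately show False using H(1) by (meson finite_UnI finite_atMost finite_subset)
    qed
    then obtain H' where "infinite H'" "H' \<subseteq> {x \<in> H. n < x}" "R n H'"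
      using thin_out[of n "{x \<in> H. n < x}"] n H(2) by blast
    then show ?thesis using n H by (intro exI[of _ "(n, H')"]) auto
  qed
  have "\<exists>p. \<forall>i. ?Q (p i) \<and> (fst (p (Suc i)) \<in> snd (p i) \<and> snd (p (Suc i)) \<subseteq> snd (p i))"
  proof (rule dependent_nat_choice)
    show "\<exists>p. ?Q p" using ex[OF assms(1) subset_refl] by blast
    show "\<exists>q. ?Q q \<and> fst q \<in> snd p \<and> snd q \<subseteq> snd p" if "?Q p" for p and i :: nat
      using ex[of "snd p"] that by blast
  qed
  then obtain p where p: "\<And>i. ?Q (p i)"
    "\<And>i. fst (p (Suc i)) \<in> snd (p i) \<and> snd (p (Suc i)) \<subseteq> snd (p i)" by blast
  have dec: "snd (p j) \<subseteq> snd (p i)" if "i \<le> j" for i j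
    using that by (induction rule: dec_induct) (use p(2) in auto)
  have mem: "fst (p j) \<in> snd (p i)" if "i < j" for i j
    using that p(2) dec by (cases j) (auto dest!: less_Suc_eq_le[THEN iffD1])
  show ?thesis
    by (rule exI[of _ "\<lambda>i. fst (p i)"], rule exI[of _ "\<lambda>i. snd (p i)"])
      (use p mem in \<open>auto simp: strict_mono_Suc_iff\<close>)
qed

text \<open>Bar induction on the finite set already fixed as an initial segment: fusion makes the
  colour depend on the next entry only, and the pigeonhole principle removes that
  dependence.\<close>

lemma nash_williams:
  fixes X :: "nat set" and D :: "nat set set" and c :: "nat set \<Rightarrow> 'a"
  assumes inf: "infinite X"
    and bar: "\<And>Z. infinite Z \<Longrightarrow> Z \<subseteq> X \<Longrightarrow> \<exists>u\<in>D. finite u \<and> initial_seg u Z"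
    and thin: "\<And>u v. u \<in> D \<Longrightarrow> v \<in> D \<Longrightarrow> initial_seg u v \<Longrightarrow> u = v"
    and K: "finite K" "K \<noteq> {}" "\<And>u. u \<in> D \<Longrightarrow> u \<subseteq> X \<Longrightarrow> c u \<in> K"
  shows "\<exists>H j. infinite H \<and> H \<subseteq> X \<and> (\<forall>u\<in>D. u \<subseteq> H \<longrightarrow> c u = j)"
proof -
  let ?hom = "\<lambda>s H j. \<forall>u\<in>D. initial_seg s u \<and> u - s \<subseteq> H \<longrightarrow> c u = j"
  \<comment> \<open>The quantifier over all \<open>Y\<close> allows the induction hypothesis for one
    entry to be applied inside a set already thinned out for earlier entries.\<close>
  define P where
    "P s \<longleftrightarrow> (\<forall>Y. infinite Y \<and> Y \<subseteq> X \<longrightarrow> (\<exists>H j. infinite H \<and> H \<subseteq> Y \<and> j \<in> K \<and> ?hom s H j))" for s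
  \<comment> \<open>By thinness \<open>s\<close> is the only member of \<open>D\<close> that has
    \<open>s\<close> as an initial segment, so \<open>H = Y\<close> works with the colour
    \<open>c s\<close>.\<close>
  have hit: "P s" if "s \<in> D" "s \<subseteq> X" for s
    unfolding P_def using thin[OF that(1)] K(3)[OF that] by blast
  have "P {}"
  proof (rule bar_induct[of X])
    fix f :: "nat \<Rightarrow> nat"
    assume f: "strict_mono f" "range f \<subseteq> X"
    then have "infinite (range f)" by (simp add: range_inj_infinite strict_mono_imp_inj_on)
    then obtain u where u: "u \<in> D" "finite u" "initial_seg u (range f)" using bar f(2) by blast
    then obtain i where "u = f ` {..<i}" using initial_seg_range f(1) by blast
    moreover have "P u" using hit[OF u(1)] u(3) f(2) unfolding initial_seg_def by blast
    ultimately show "\<exists>i. P (f ` {..<i})" by blast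
  next
    fix s :: "nat set"
    assume s: "finite s" "s \<subseteq> X"
      and IH: "\<And>n. n \<in> X \<Longrightarrow> precedes s {n} \<Longrightarrow> P (insert n s)"
    show "P s"
    proof (cases "s \<in> D")
      case True
      then show ?thesis using hit s(2) by blast
    next
      case False
      show ?thesis
        unfolding P_def
      proof (intro allI impI)
        fix Y assume Y: "infinite Y \<and> Y \<subseteq> X"
        let ?Y = "{n \<in> Y. precedes s {n}}"
        obtain b where b: "\<forall>x\<in>s. x < b" using s(1) finite_nat_set_iff_bounded by blast
        have "Y \<subseteq> ?Y \<union> {..<b}" using b by (auto simp: precedes_def)
        then have infY: "infinite ?Y"
          using Y by (meson finite_UnI finite_lessThan finite_subset)
        define R where "R n H \<longleftrightarrow> (\<exists>j\<in>K. ?hom (insert n s) H j)" for n H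
        have "\<exists>(f :: nat \<Rightarrow> nat) H. strict_mono f \<and> range f \<subseteq> ?Y \<and> (\<forall>i. R (f i) (H i)) \<and>
          (\<forall>i j. i < j \<longrightarrow> f j \<in> H i)"
        proof (rule diagonal_sequence[OF infY])
          fix n H assume "n \<in> ?Y" "infinite H" "H \<subseteq> ?Y"
          then show "\<exists>H'. infinite H' \<and> H' \<subseteq> H \<and> R n H'"
            using IH[of n, unfolded P_def, rule_format, of H] Y unfolding R_def by blast
        qed
        then obtain f :: "nat \<Rightarrow> nat" and H
          where "strict_mono f \<and> range f \<subseteq> ?Y \<and> (\<forall>i. R (f i) (H i)) \<and>
            (\<forall>i j. i < j \<longrightarrow> f j \<in> H i)"
          by (elim exE) (rule that)
        then have f: "strict_mono f" "range f \<subseteq> ?Y"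
          and R: "\<And>i. R (f i) (H i)" and fH: "\<And>i j. i < j \<Longrightarrow> f j \<in> H i"
          by simp_all
        obtain g where g: "\<And>i. g i \<in> K \<and> ?hom (insert (f i) s) (H i) (g i)"
          using R unfolding R_def by metis
        have "range g \<subseteq> K" using g by blast
        then have "finite (range g)" using K(1) finite_subset by blast
        then obtain i0 where i0: "infinite {i. g i = g i0}"
          using pigeonhole_infinite[of "UNIV :: nat set" g] by auto
        \<comment> \<open>The entries \<open>f i\<close> whose associated colour \<open>g i\<close>
          is one value taken infinitely often.\<close>
        let ?H = "f ` {i. g i = g i0}"
        have "infinite ?H"
          using i0 f(1) finite_imageD strict_mono_imp_inj_on inj_on_subset subset_UNIV by metis
        moreover have "?H \<subseteq> Y" using f(2) by auto
        moreover have "g i0 \<in> K" using g by blast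
        moreover have "?hom s ?H (g i0)"
        proof (intro ballI impI)
          fix u assume u: "u \<in> D" "initial_seg s u \<and> u - s \<subseteq> ?H"
          then have "u - s \<noteq> {}" using False by (auto simp: initial_seg_def)
          then obtain n where n: "n \<in> u - s" "initial_seg (insert n s) u"
            and least: "\<And>y. y \<in> u - s \<Longrightarrow> n \<le> y"
            using initial_seg_insert_least u(2) by metis
          from n(1) u(2) have "n \<in> ?H" by (rule subsetD[rotated, OF _ conjunct2])
          then obtain i where i: "n = f i" "g i = g i0" by blast
          \<comment> \<open>As \<open>n = f i\<close> is the least new entry of \<open>u\<close>,
            all others are some \<open>f j\<close> with \<open>i < j\<close>, so the homogeneity of
            \<open>H i\<close> applies to \<open>u\<close>.\<close>
          have "u - insert n s \<subseteq> H i"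
          proof
            fix y assume y: "y \<in> u - insert n s"
            then obtain j where j: "y = f j" using u by blast
            have "f i < f j" using y least[of y] i j by auto
            then show "y \<in> H i" using fH j f(1) by (simp add: strict_mono_less)
          qed
          then show "c u = g i0" using g[of i] u(1) n(2) i by simp
        qed
        ultimately show "\<exists>H j. infinite H \<and> H \<subseteq> Y \<and> j \<in> K \<and> ?hom s H j"
          by (intro exI conjI)
      qed
    qed
  qed
  then have "\<exists>H j. infinite H \<and> H \<subseteq> X \<and> j \<in> K \<and> ?hom {} H j"
    unfolding P_def using inf by (elim allE[of _ X] impE) simp_all
  then show ?thesis by (simp add: initial_seg_def) metis
qed

section \<open>Good sets\<close>

definition good :: "nat set set \<Rightarrow> nat set set \<Rightarrow> nat \<Rightarrow> nat set \<Rightarrow> bool"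
  where "good A C k s \<longleftrightarrow> (\<forall>c \<in> subsets_in s C \<rightarrow> {..<k}.
    \<exists>t \<in> C \<oplus>\<^sub>f A. t \<subseteq> s \<and> (\<exists>i. \<forall>u \<in> subsets_in t C. c u = i))"

lemma arrows_iff_good: "arrows B A C k \<longleftrightarrow> (\<forall>s \<in> singletons (base B) \<oplus>\<^sub>f B. good A C k s)"
  by (simp add: arrows_def good_def)

lemma good_mono:
  assumes "good A C k s" "s \<subseteq> s'"
  shows "good A C k s'"
  unfolding good_def
proof
  fix c assume "c \<in> subsets_in s' C \<rightarrow> {..<k}"
  then have "c \<in> subsets_in s C \<rightarrow> {..<k}" using assms(2) by (auto simp: subsets_in_def)
  then have "\<exists>t \<in> C \<oplus>\<^sub>f A. t \<subseteq> s \<and> (\<exists>i. \<forall>u \<in> subsets_in t C. c u = i)"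
    using assms(1) unfolding good_def by (rule bspec[rotated])
  then show "\<exists>t \<in> C \<oplus>\<^sub>f A. t \<subseteq> s' \<and> (\<exists>i. \<forall>u \<in> subsets_in t C. c u = i)"
    using assms(2) by (elim bexE conjE) (intro bexI conjI, auto)
qed

text \<open>
  Colouring \<open>u \<union> {m}\<close> by the colour of \<open>u\<close> in a bad colouring of \<open>X \<inter> {..<m}\<close> replaces the
  compactness argument: on a homogeneous set the colour does not depend on \<open>m\<close>.
\<close>

lemma ex_good_initial:
  assumes A: "front A" and C: "front C" and sub: "base A \<subseteq> base C"
    and X: "infinite X" "X \<subseteq> base A"
  shows "\<exists>m. good A C k (X \<inter> {..<m})"
proof (rule ccontr)
  assume "\<nexists>m. good A C k (X \<inter> {..<m})"
  then have "\<exists>c. c \<in> subsets_in (X \<inter> {..<m}) C \<rightarrow> {..<k} \<and>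
    (\<forall>t. t \<in> C \<oplus>\<^sub>f A \<longrightarrow> t \<subseteq> X \<inter> {..<m} \<longrightarrow>
      \<not> (\<exists>i. \<forall>u \<in> subsets_in t C. c u = i))" for m
    unfolding good_def Bex_def by (metis (no_types, lifting))
  then obtain c where c: "\<And>m. c m \<in> subsets_in (X \<inter> {..<m}) C \<rightarrow> {..<k}"
    and bad: "\<And>m t. t \<in> C \<oplus>\<^sub>f A \<Longrightarrow> t \<subseteq> X \<inter> {..<m} \<Longrightarrow>
      \<not> (\<exists>i. \<forall>u \<in> subsets_in t C. c m u = i)" by metis
  \<comment> \<open>Members of \<open>C\<close> with one further last entry. That entry, recovered
    by \<open>Max\<close> in \<open>d\<close>, selects the bad colouring to be consulted.\<close>
  define D where "D = {insert m u | m u. u \<in> C \<and> precedes u {m}}"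
  define d where "d v = c (Max v) (v - {Max v})" for v
  have d_insert: "d (insert m u) = c m u" if "u \<in> C" "precedes u {m}" for m u
  proof -
    have "finite u" using that(1) C front_finite by blast
    moreover have "\<forall>x\<in>u. x < m" using that(2) by (simp add: precedes_def)
    ultimately have "Max (insert m u) = m" "m \<notin> u"
      by (auto intro!: Max_eqI dest: less_imp_le)
    then show ?thesis unfolding d_def by simp
  qed
  have bound: "\<exists>b\<in>Z. \<forall>x\<in>t. x < b" if "infinite Z" "finite t" for Z t :: "nat set"
  proof -
    obtain b where "\<forall>x\<in>t. x < b" using \<open>finite t\<close> finite_nat_set_iff_bounded by blast
    moreover obtain n where "n \<in> Z" "b < n" using \<open>infinite Z\<close> infinite_nat_iff_unbounded by blast
    ultimately show ?thesis by (meson less_trans)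
  qed
  have bar: "\<exists>v\<in>D. finite v \<and> initial_seg v Z" if Z: "infinite Z" "Z \<subseteq> X" for Z
  proof -
    have "Z \<subseteq> base C" using X sub Z by blast
    then obtain u where u: "u \<in> C" "finite u" "initial_seg u Z" using front_bar C Z(1) by blast
    have "Z - u \<noteq> {}" using Z(1) u(2) by (metis Diff_eq_empty_iff finite_subset)
    then obtain m where m: "precedes u {m}" "initial_seg (insert m u) Z"
      using initial_seg_insert_least u(3) by metis
    have "insert m u \<in> D" using u(1) m(1) unfolding D_def by blast
    then show ?thesis using m(2) u(2) by (intro bexI[of _ "insert m u"]) simp_all
  qed
  have thin: "v = w" if vw: "v \<in> D" "w \<in> D" "initial_seg v w" for v w
  proof -
    from vw obtain m u m' u' where v: "v = insert m u" "u \<in> C" "precedes u {m}"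
      and w: "w = insert m' u'" "u' \<in> C" "precedes u' {m'}" unfolding D_def by blast
    have "initial_seg u v" "initial_seg u' w"
      using v w by (fastforce simp: initial_seg_def precedes_def)+
    \<comment> \<open>Both \<open>u\<close> and \<open>u'\<close> are initial segments of
      \<open>w\<close>, hence comparable, hence equal because \<open>C\<close> is thin.\<close>
    then have "u = u'"
      using initial_seg_trans[OF _ vw(3)] initial_seg_cases front_thin[OF C] v(2) w(2) by metis
    moreover have "m \<notin> u" using v(3) by (auto simp: precedes_def)
    moreover have "m \<in> w" using v(1) vw(3) by (auto simp: initial_seg_def)
    ultimately show ?thesis using v w by auto
  qed
  have col: "d v \<in> {..k}" if "v \<in> D" "v \<subseteq> X" for v
  proof -
    from that obtain m u where v: "v = insert m u" "u \<in> C" "precedes u {m}" unfolding D_def by blast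
    then have "u \<in> subsets_in (X \<inter> {..<m}) C"
      using \<open>v \<subseteq> X\<close> by (auto simp: subsets_in_def precedes_def)
    then have "c m u < k" using c by auto
    then show ?thesis using v d_insert by simp
  qed
  have "\<exists>H j. infinite H \<and> H \<subseteq> X \<and> (\<forall>v\<in>D. v \<subseteq> H \<longrightarrow> d v = j)"
    \<comment> \<open>The colours are taken from \<open>{..k}\<close>, which is nonempty also for
      \<open>k = 0\<close>.\<close>
    by (rule nash_williams[where K="{..k}"]) (use X(1) bar thin col in auto)
  then obtain H j where hom: "infinite H \<and> H \<subseteq> X \<and> (\<forall>v\<in>D. v \<subseteq> H \<longrightarrow> d v = j)"
    by (elim exE) (rule that)
  then have H: "infinite H" "H \<subseteq> X" by simp_all
  have "H \<subseteq> base A" using H X by blast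
  then obtain a where a: "a \<in> A" "finite a" "initial_seg a H" using front_bar A H(1) by blast
  have inf: "infinite (H - a)" using H a by simp
  moreover have "H - a \<subseteq> base C" using \<open>H \<subseteq> base A\<close> sub by blast
  ultimately obtain b where b: "b \<in> C" "finite b" "initial_seg b (H - a)"
    using front_bar C by blast
  have "precedes a b"
    using initial_seg_precedes[OF a(3)] b(3) by (auto simp: precedes_def initial_seg_def)
  then have t: "a \<union> b \<in> C \<oplus>\<^sub>f A" using a b by (auto simp: front_sum_def)
  have tH: "a \<union> b \<subseteq> H" using a b by (auto simp: initial_seg_def)
  \<comment> \<open>Appending this one \<open>m\<close> to any \<open>C\<close>-size subset of
    \<open>a \<union> b\<close> gives a member of \<open>D\<close> inside \<open>H\<close>. So the
    single colouring \<open>c m\<close> is constant on these subsets, although it was chosen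
    bad.\<close>
  obtain m where m: "m \<in> H" "\<forall>x\<in>a \<union> b. x < m" using bound[of H "a \<union> b"] H(1) a(2) b(2) by blast
  have "c m u = j" if "u \<in> subsets_in (a \<union> b) C" for u
  proof -
    have "u \<in> C" "precedes u {m}" "insert m u \<subseteq> H"
      using that m tH by (auto simp: subsets_in_def precedes_def)
    moreover from this have "insert m u \<in> D" unfolding D_def by blast
    ultimately show ?thesis using hom d_insert by metis
  qed
  moreover have "a \<union> b \<subseteq> X \<inter> {..<m}" using tH H m by auto
  ultimately show False using bad[OF t] by blast
qed

section \<open>Domination\<close>

text \<open>Compactness of Cantor space: \<open>Y\<close> is a cluster point of the sequence. A
  trace below \<open>m\<close> that occurs infinitely often has only finitely many extensions to a
  trace below \<open>Suc m\<close>, so one of them again occurs infinitely often.\<close>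

lemma cluster_set:
  fixes \<sigma> :: "nat \<Rightarrow> nat set"
  obtains Y where "\<And>m. \<exists>n\<ge>m. Y \<inter> {..<m} = \<sigma> n \<inter> {..<m}"
proof -
  let ?N = "\<lambda>m y. {n. \<sigma> n \<inter> {..<m} = y}"
  have "\<exists>y. \<forall>m. infinite (?N m (y m)) \<and> y (Suc m) \<inter> {..<m} = y m"
  proof (rule dependent_nat_choice)
    show "\<exists>y. infinite (?N 0 y)" by (intro exI[of _ "{}"]) simp
  next
    fix y m assume inf: "infinite (?N m y)"
    let ?I = "{z. z \<subseteq> {..<Suc m} \<and> z \<inter> {..<m} = y}"
    have "?N m y \<subseteq> (\<Union>z\<in>?I. ?N (Suc m) z)"
    proof
      fix n assume n: "n \<in> ?N m y"
      have "\<sigma> n \<inter> {..<Suc m} \<inter> {..<m} = \<sigma> n \<inter> {..<m}" by auto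
      then have "\<sigma> n \<inter> {..<Suc m} \<in> ?I" using n by simp
      then show "n \<in> (\<Union>z\<in>?I. ?N (Suc m) z)" by (rule UN_I) simp
    qed
    then have "infinite (\<Union>z\<in>?I. ?N (Suc m) z)" using inf by (rule infinite_super)
    moreover have "finite ?I" by (rule finite_subset[of _ "Pow {..<Suc m}"]) auto
    ultimately show "\<exists>z. infinite (?N (Suc m) z) \<and> z \<inter> {..<m} = y"
      using finite_UN[of ?I "?N (Suc m)"] by auto
  qed
  then obtain y where y: "\<And>m. infinite (?N m (y m))" "\<And>m. y (Suc m) \<inter> {..<m} = y m" by blast
  have sub: "y m \<subseteq> {..<m}" for m using y(2)[of m] by blast
  \<comment> \<open>\<open>y (Suc x)\<close> is the first trace that can contain \<open>x\<close>;
    later traces do not change the decision.\<close>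
  define Y where "Y = {x. x \<in> y (Suc x)}"
  have Y: "Y \<inter> {..<m} = y m" for m
  proof (induction m)
    case 0
    then show ?case using sub[of 0] by simp
  next
    case (Suc m)
    have "Y \<inter> {..<Suc m} = (Y \<inter> {..<m}) \<union> (Y \<inter> {m})" by (auto simp: lessThan_Suc)
    also have "\<dots> = (y (Suc m) \<inter> {..<m}) \<union> (y (Suc m) \<inter> {m})" using Suc y(2) by (auto simp: Y_def)
    also have "\<dots> = y (Suc m)" using sub[of "Suc m"] by (auto simp: lessThan_Suc)
    finally show ?case .
  qed
  show thesis
  proof
    fix m
    obtain n where "n \<in> ?N m (y m)" "m \<le> n" using y(1)[of m] unfolding infinite_nat_iff_unbounded_le by blast
    then show "\<exists>n\<ge>m. Y \<inter> {..<m} = \<sigma> n \<inter> {..<m}" using Y by auto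
  qed
qed

text \<open>
  For finite sets: \<open>t\<close> has at most as many entries as \<open>s\<close>, and each of them is at least the
  corresponding entry of \<open>s\<close>.
\<close>

definition dominated :: "nat set \<Rightarrow> nat set \<Rightarrow> bool"
  where "dominated t s \<longleftrightarrow> (\<forall>m. card (t \<inter> {..<m}) \<le> card (s \<inter> {..<m}))"

lemma dominated_trans: "dominated r t \<Longrightarrow> dominated t s \<Longrightarrow> dominated r s"
  unfolding dominated_def by (meson le_trans)

lemma subset_dominated: "t \<subseteq> s \<Longrightarrow> dominated t s"
  unfolding dominated_def by (auto intro!: card_mono)

lemma dominated_empty: "dominated t {} \<Longrightarrow> t = {}"
  unfolding dominated_def by (auto simp: card_eq_0_iff)

text \<open>Comparing counts below \<open>Suc m\<close> forces \<open>n \<le> m\<close>. For bounds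
  above \<open>m\<close> both counts then drop by exactly one; for the others nothing of
  \<open>t\<close> is left. This allows recursion on the first entry.\<close>

lemma dominated_remove_least:
  assumes "dominated t (insert n s)" "precedes {n} s" "t \<noteq> {}"
  obtains m u where "t = insert m u" "precedes {m} u" "n \<le> m" "dominated u s"
proof -
  define m where "m = (LEAST m. m \<in> t)"
  have m: "m \<in> t" unfolding m_def by (rule LeastI_ex) (use assms(3) in blast)
  have least: "m \<le> y" if "y \<in> t" for y using that unfolding m_def by (rule Least_le)
  have n: "n \<notin> s" using assms(2) by (auto simp: precedes_def)
  have count: "card (t \<inter> {..<j}) \<le> card (insert n s \<inter> {..<j})" for j
    using assms(1) by (simp add: dominated_def)
  show thesis
  proof
    show "t = insert m (t - {m})" using m by blast
    show "precedes {m} (t - {m})" using least by (force simp: precedes_def)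
    show "n \<le> m"
    proof (rule ccontr)
      assume "\<not> n \<le> m"
      then have "insert n s \<inter> {..<Suc m} = {}" using assms(2) by (force simp: precedes_def)
      then have "t \<inter> {..<Suc m} = {}" using count[of "Suc m"] by simp
      then show False using m by auto
    qed
    show "dominated (t - {m}) s"
      unfolding dominated_def
    proof
      fix j
      show "card ((t - {m}) \<inter> {..<j}) \<le> card (s \<inter> {..<j})"
      proof (cases "m < j")
        case True
        then have "(t - {m}) \<inter> {..<j} = (t \<inter> {..<j}) - {m}"
          "insert n s \<inter> {..<j} = insert n (s \<inter> {..<j})" using \<open>n \<le> m\<close> by auto
        moreover have "m \<in> t \<inter> {..<j}" using m True by simp
        ultimately show ?thesis using count[of j] n by simp
      next
        case False
        then have "(t - {m}) \<inter> {..<j} = {}" using least by force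
        then show ?thesis by simp
      qed
    qed
  qed
qed

text \<open>Closing \<open>S\<close> under domination keeps it barred. Otherwise all traces of
  \<open>Z\<close> are dominated by members of \<open>S\<close>; a cluster point \<open>Y\<close> of
  these has every trace in \<open>S\<close> by heredity and at least as many entries below each
  bound as \<open>Z\<close>, so it is an infinite subset of \<open>X\<close> that never leaves
  \<open>S\<close>.\<close>

lemma spread_bar:
  assumes hered: "\<And>s t. s \<in> S \<Longrightarrow> t \<subseteq> s \<Longrightarrow> t \<in> S"
    and sub: "\<And>s. s \<in> S \<Longrightarrow> s \<subseteq> X"
    and bar: "\<And>Y. infinite Y \<Longrightarrow> Y \<subseteq> X \<Longrightarrow> \<exists>m. Y \<inter> {..<m} \<notin> S"
    and Z: "infinite (Z :: nat set)"
  shows "\<exists>m. \<forall>s\<in>S. \<not> dominated (Z \<inter> {..<m}) s"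
proof (rule ccontr)
  assume "\<not> ?thesis"
  then have "\<forall>n. \<exists>s. s \<in> S \<and> dominated (Z \<inter> {..<n}) s" by blast
  then obtain \<sigma> where \<sigma>: "\<And>n. \<sigma> n \<in> S \<and> dominated (Z \<inter> {..<n}) (\<sigma> n)" by metis
  obtain Y where Y: "\<And>m. \<exists>n\<ge>m. Y \<inter> {..<m} = \<sigma> n \<inter> {..<m}" using cluster_set by blast
  have YS: "Y \<inter> {..<m} \<in> S" for m using Y[of m] hered \<sigma> by (metis inf_le1)
  have count: "card (Z \<inter> {..<m}) \<le> card (Y \<inter> {..<m})" for m
  proof -
    obtain n where n: "n \<ge> m" "Y \<inter> {..<m} = \<sigma> n \<inter> {..<m}" using Y by blast
    \<comment> \<open>Here \<open>n \<ge> m\<close> matters: cutting \<open>Z\<close> at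
      \<open>n\<close> loses nothing below \<open>m\<close>.\<close>
    have "Z \<inter> {..<n} \<inter> {..<m} = Z \<inter> {..<m}" using n(1) by auto
    then show ?thesis using \<sigma>[of n] n(2) unfolding dominated_def by metis
  qed
  have "infinite Y"
  proof
    assume fin: "finite Y"
    obtain F where F: "F \<subseteq> Z" "finite F" "card F = Suc (card Y)"
      using Z infinite_arbitrarily_large by blast
    obtain m where "\<forall>x\<in>F. x < m" using F(2) finite_nat_set_iff_bounded by blast
    then have "card F \<le> card (Z \<inter> {..<m})" using F(1) by (intro card_mono) auto
    also have "\<dots> \<le> card (Y \<inter> {..<m})" by (rule count)
    also have "\<dots> \<le> card Y" using fin by (intro card_mono) auto
    finally show False using F(3) by simp
  qed
  moreover have "Y \<subseteq> X"
  proof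
    fix x assume "x \<in> Y"
    then show "x \<in> X" using sub[OF YS[of "Suc x"]] by auto
  qed
  ultimately show False using bar YS by blast
qed

section \<open>Ranks of families\<close>

text \<open>Cutting \<open>s\<close> off lets ranks be defined by recursion on families alone, with
  no node of a tree carried along.\<close>

definition after :: "nat set \<Rightarrow> nat set set \<Rightarrow> nat set set"
  where "after s S = {t. precedes s t \<and> s \<union> t \<in> S}"

lemma after_empty: "after {} S = S"
  by (simp add: after_def precedes_def)

lemma after_after:
  "after {n} (after s S) = (if precedes s {n} then after (insert n s) S else {})"
  by (auto simp: after_def precedes_def)

text \<open>A relation for upper bounds makes sense before well-foundedness is known. The empty
  family gets rank 0 and \<open>{{}}\<close> rank 1, so that a leaf, which lies just outside the
  family, has rank 0 as in \<open>ht_at\<close>.\<close>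

inductive rank_le :: "cord \<Rightarrow> nat set set \<Rightarrow> bool" where
  empty: "rank_le a {}"
| step: "(\<And>n. \<exists>b<a. rank_le b (after {n} S)) \<Longrightarrow> rank_le a S"

lemma rank_le_mono:
  assumes "rank_le a S" "a \<le> b"
  shows "rank_le b S"
  using assms(1)
proof cases
  case empty
  then show ?thesis by (simp add: rank_le.empty)
next
  case step
  show ?thesis
  proof (rule rank_le.step)
    fix n
    obtain c where "c < a" "rank_le c (after {n} S)" using step by blast
    then show "\<exists>c<b. rank_le c (after {n} S)" using assms(2) less_le_trans by blast
  qed
qed

lemma rank_le_subset: "rank_le a S \<Longrightarrow> T \<subseteq> S \<Longrightarrow> rank_le a T"
proof (induction arbitrary: T rule: rank_le.induct)
  case (step a S)
  have "after {n} T \<subseteq> after {n} S" for n using step.prems by (auto simp: after_def)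
  then show ?case using step.IH by (intro rank_le.step) blast
qed (simp add: rank_le.empty)

text \<open>\<open>after\<close> commutes with unions, and the maximum of two ordinals below
  \<open>a\<close> is again below \<open>a\<close>.\<close>

lemma rank_le_Un: "rank_le a S \<Longrightarrow> rank_le a T \<Longrightarrow> rank_le a (S \<union> T)"
proof (induction a arbitrary: S T rule: less_induct)
  case (less a)
  show ?case
  proof (cases "S = {} \<or> T = {}")
    case True
    then show ?thesis using less.prems by auto
  next
    case False
    have S: "\<exists>b<a. rank_le b (after {n} S)" and T: "\<exists>b<a. rank_le b (after {n} T)" for n
      using less.prems False by (auto elim: rank_le.cases)
    show ?thesis
    proof (rule rank_le.step)
      fix n
      obtain b c where bc: "b < a" "rank_le b (after {n} S)" "c < a" "rank_le c (after {n} T)"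
        using S T by blast
      have "after {n} (S \<union> T) = after {n} S \<union> after {n} T" by (auto simp: after_def)
      moreover have "rank_le (max b c) (after {n} S)" "rank_le (max b c) (after {n} T)"
        using bc rank_le_mono by auto
      ultimately show "\<exists>b<a. rank_le b (after {n} (S \<union> T))"
        using less.IH[of "max b c"] bc by (metis max_less_iff_conj)
    qed
  qed
qed

lemma rank_le_UN:
  assumes "finite I" "\<And>i. i \<in> I \<Longrightarrow> rank_le a (S i)"
  shows "rank_le a (\<Union>i\<in>I. S i)"
  using assms by (induction rule: finite_induct) (simp_all add: rank_le_Un rank_le.empty)

text \<open>Passing to \<open>after {f 0} S\<close> lowers the rank and removes the first entry of
  \<open>f\<close>, so the induction continues with the shifted sequence.\<close>

lemma rank_le_bar:
  assumes "rank_le a S" "strict_mono (f :: nat \<Rightarrow> nat)"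
  shows "\<exists>i. f ` {..<i} \<notin> S"
  using assms
proof (induction arbitrary: f rule: rank_le.induct)
  case (step a S)
  then obtain i where i: "(f \<circ> Suc) ` {..<i} \<notin> after {f 0} S"
    using strict_mono_less[OF step.prems] by (metis (no_types, lifting) Suc_less_eq comp_apply strict_monoI)
  have "precedes {f 0} ((f \<circ> Suc) ` {..<i})"
    using step.prems by (auto simp: precedes_def strict_mono_less)
  moreover have "{f 0} \<union> (f \<circ> Suc) ` {..<i} = f ` {..<Suc i}"
    by (simp add: lessThan_Suc_eq_insert_0 image_comp)
  ultimately show ?case using i by (auto simp: after_def)
qed simp

text \<open>Bar induction on \<open>s\<close> for the existence of a rank of
  \<open>after s S\<close>. By heredity this family is empty as soon as \<open>s\<close> has left
  \<open>S\<close>.\<close>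

lemma ex_rank_le:
  assumes hered: "\<And>s t. s \<in> S \<Longrightarrow> t \<subseteq> s \<Longrightarrow> t \<in> S"
    and bar: "\<And>f :: nat \<Rightarrow> nat. strict_mono f \<Longrightarrow> \<exists>i. f ` {..<i} \<notin> S"
  shows "\<exists>a. rank_le a S"
proof -
  have "\<exists>a. rank_le a (after {} S)"
  proof (rule bar_induct[of UNIV])
    fix f :: "nat \<Rightarrow> nat"
    assume "strict_mono f"
    then obtain i where i: "f ` {..<i} \<notin> S" using bar by blast
    have "after (f ` {..<i}) S = {}" using i hered by (auto simp: after_def)
    then show "\<exists>i a. rank_le a (after (f ` {..<i}) S)" using rank_le.empty by metis
  next
    fix s :: "nat set"
    assume IH: "\<And>n. n \<in> UNIV \<Longrightarrow> precedes s {n} \<Longrightarrow> \<exists>a. rank_le a (after (insert n s) S)"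
    have "\<exists>a. rank_le a (after {n} (after s S))" for n
      using IH[of n] rank_le.empty by (simp add: after_after)
    then obtain a where a: "\<And>n. rank_le (a n) (after {n} (after s S))" by metis
    \<comment> \<open>Countably many countable ordinals have a countable strict bound.\<close>
    obtain b where "\<forall>x\<in>range a. x < b" using countable_bounded_cord[of "range a"] by auto
    then show "\<exists>a. rank_le a (after s S)" using a by (blast intro: rank_le.step)
  qed
  then show ?thesis by (simp add: after_empty)
qed

text \<open>At a least counterexample put \<open>c = omega_pow a < a\<close>. Then
  \<open>omega_pow c\<close> doubled is at most \<open>omega_pow a = c\<close>, so
  \<open>omega_pow c < c\<close>, against minimality. Any rank can thus be raised to a power of
  \<open>\<omega>\<close>.\<close>

lemma le_omega_pow: "a \<le> omega_pow a"
proof (induction a rule: less_induct)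
  case (less a)
  show ?case
  proof (rule ccontr)
    assume "\<not> a \<le> omega_pow a"
    then have lt: "omega_pow a < a" by simp
    let ?c = "omega_pow a"
    have "0 < omega_pow ?c"
      using one_le_omega_pow less_ord_succ[of 0] by (metis one_cord_def less_le_trans)
    then have "omega_pow ?c < omega_pow ?c + omega_pow ?c"
      using add_less_cord[of 0 "omega_pow ?c" "omega_pow ?c"] by (simp add: add_zero_cord)
    also have "\<dots> \<le> omega_pow a"
      using mult_le_omega_pow[OF lt, of 2] by (simp add: numeral_2_eq_2 zero_add_cord)
    finally show False using less[OF lt] by simp
  qed
qed

text \<open>A family of rank exactly \<open>a\<close>, whatever infinite base it is restricted to.\<close>

inductive canonical :: "cord \<Rightarrow> nat set \<Rightarrow> bool" where
  empty: "0 < a \<Longrightarrow> canonical a {}"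
| insert: "0 < a \<Longrightarrow> i \<le> n \<Longrightarrow> canonical (from_nat_into {..<a} i) t \<Longrightarrow> precedes {n} t \<Longrightarrow>
    canonical a (insert n t)"

text \<open>Moving the first entry from \<open>n\<close> up to \<open>m\<close> keeps the index
  admissible, since \<open>i \<le> n \<le> m\<close>; the remaining entries are handled by
  induction.\<close>

lemma canonical_dominated: "canonical a s \<Longrightarrow> dominated t s \<Longrightarrow> canonical a t"
proof (induction arbitrary: t rule: canonical.induct)
  case (empty a)
  then show ?case using dominated_empty canonical.empty by blast
next
  case (insert a i n s)
  show ?case
  proof (cases "t = {}")
    case True
    then show ?thesis using insert.hyps canonical.empty by blast
  next
    case False
    then obtain m u where "t = insert m u" "precedes {m} u" "n \<le> m" "dominated u s"
      using dominated_remove_least insert.prems insert.hyps by metis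
    then show ?thesis
      using insert.IH insert.hyps by (auto intro: canonical.insert[of a i])
  qed
qed

lemma from_nat_into_lessThan: "0 < a \<Longrightarrow> from_nat_into {..<a :: cord} i < a"
  using from_nat_into[of "{..<a}" i] by fastforce

lemma after_canonical:
  "after {n} (Collect (canonical a)) \<subseteq> (\<Union>i\<in>{..n}. Collect (canonical (from_nat_into {..<a} i)))"
proof
  fix t assume "t \<in> after {n} (Collect (canonical a))"
  then have "canonical a (insert n t)" and t: "precedes {n} t" by (auto simp: after_def)
  then show "t \<in> (\<Union>i\<in>{..n}. Collect (canonical (from_nat_into {..<a} i)))"
  proof cases
    case (insert i m u)
    have "m = n"
      using insert(1,5) t unfolding precedes_def by (metis insertE insertI1 less_asym singletonI)
    moreover from this have "u = t"
      using insert(1,5) t by (metis insert_ident less_irrefl precedes_def singletonI)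
    ultimately show ?thesis using insert by auto
  qed simp
qed

lemma canonical_pos: "canonical a s \<Longrightarrow> 0 < a"
  by (induction rule: canonical.induct) auto

text \<open>After a first entry \<open>n\<close> only the ordinals with index at most
  \<open>n\<close> in the enumeration of \<open>{..<a}\<close> can follow. They are finitely many,
  so their maximum is still below \<open>a\<close> and bounds the rank of the union.\<close>

lemma rank_le_canonical: "rank_le a (Collect (canonical a))"
proof (induction a rule: less_induct)
  case (less a)
  show ?case
  proof (cases "0 < a")
    case True
    let ?e = "from_nat_into {..<a}"
    have e: "?e i < a" for i using True by (rule from_nat_into_lessThan)
    show ?thesis
    proof (rule rank_le.step)
      fix n
      let ?b = "Max (?e ` {..n})"
      have "?b \<in> ?e ` {..n}" by (rule Max_in) auto
      then have "?b < a" using e by auto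
      have "rank_le ?b (\<Union>i\<in>{..n}. Collect (canonical (?e i)))"
      proof (rule rank_le_UN)
        fix i assume "i \<in> {..n}"
        then have "?e i \<le> ?b" by simp
        then show "rank_le ?b (Collect (canonical (?e i)))" using less e rank_le_mono by blast
      qed simp
      then have "rank_le ?b (after {n} (Collect (canonical a)))"
        using after_canonical rank_le_subset by blast
      then show "\<exists>b<a. rank_le b (after {n} (Collect (canonical a)))" using \<open>?b < a\<close> by blast
    qed
  next
    case False
    then have "Collect (canonical a) = {}" using canonical_pos by blast
    then show ?thesis using rank_le.empty by simp
  qed
qed
section \<open>The barrier of minimal non-members\<close>

definition boundary :: "nat set \<Rightarrow> nat set set \<Rightarrow> nat set set"
  where "boundary X S =
    {s. finite s \<and> s \<subseteq> X \<and> s \<notin> S \<and> (\<forall>u. proper_initial_seg u s \<longrightarrow> u \<in> S)}"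

text \<open>Closure under domination will make the boundary smooth and free of proper inclusions,
  \<open>bar\<close> makes it a front, and \<open>empty_mem\<close> keeps it from being
  degenerate.\<close>

locale spread_family =
  fixes X :: "nat set" and S :: "nat set set"
  assumes infinite_X: "infinite X"
    and dominated_mem: "s \<in> S \<Longrightarrow> dominated t s \<Longrightarrow> t \<in> S"
    and empty_mem: "{} \<in> S"
    and bar: "strict_mono (f :: nat \<Rightarrow> nat) \<Longrightarrow> \<exists>i. f ` {..<i} \<notin> S"
begin

abbreviation "B \<equiv> boundary X S"

lemma subset_mem: "s \<in> S \<Longrightarrow> t \<subseteq> s \<Longrightarrow> t \<in> S"
  using dominated_mem subset_dominated by blast

lemma boundaryD:
  assumes "s \<in> B"
  shows "finite s" "s \<subseteq> X" "s \<notin> S" "\<And>u. proper_initial_seg u s \<Longrightarrow> u \<in> S"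
  using assms by (simp_all add: boundary_def)

lemma boundary_initial:
  assumes "finite s" "s \<subseteq> X" "s \<notin> S"
  obtains u where "u \<in> B" "initial_seg u s"
proof -
  let ?P = "\<lambda>u. initial_seg u s \<and> u \<notin> S"
  have "?P s" using assms(3) by (simp add: initial_seg_def)
  then obtain u where u: "?P u" and min: "\<And>v. ?P v \<Longrightarrow> card u \<le> card v"
    using ex_has_least_nat[of ?P s card] by blast
  have us: "u \<subseteq> s" using u by (simp add: initial_seg_def)
  then have fin: "finite u" using assms(1) finite_subset by blast
  have "v \<in> S" if "proper_initial_seg v u" for v
  proof (rule ccontr)
    assume "v \<notin> S"
    then have "card u \<le> card v"
      using min u that initial_seg_trans unfolding proper_initial_seg_def by blast
    moreover have "v \<subset> u" using that by (auto simp: proper_initial_seg_def initial_seg_def)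
    ultimately show False using psubset_card_mono[OF fin, of v] by simp
  qed
  moreover have "u \<subseteq> X" using us assms(2) by (rule subset_trans)
  ultimately have "u \<in> B" using fin u by (simp add: boundary_def)
  then show thesis using that u by simp
qed

lemma boundary_bar:
  assumes "infinite Z" "Z \<subseteq> X"
  obtains u where "u \<in> B" "proper_initial_seg u Z"
proof -
  obtain i where i: "enumerate Z ` {..<i} \<notin> S"
    using bar strict_mono_enumerate[OF assms(1)] by blast
  let ?s = "enumerate Z ` {..<i}"
  have "range (enumerate Z) = Z" using range_enumerate[OF assms(1)] .
  then have sub: "?s \<subseteq> Z" by blast
  have init: "initial_seg ?s Z"
    unfolding initial_seg_def
  proof (intro conjI sub ballI impI)
    fix x y assume "x \<in> ?s" "y \<in> Z" "y < x"
    then obtain k j where "x = enumerate Z k" "k < i" "y = enumerate Z j"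
      using \<open>range (enumerate Z) = Z\<close> by blast
    moreover from this have "j < k"
      using \<open>y < x\<close> strict_mono_less[OF strict_mono_enumerate[OF assms(1)]] by simp
    ultimately show "y \<in> ?s" by auto
  qed
  obtain u where u: "u \<in> B" "initial_seg u ?s"
    using boundary_initial[of ?s] i sub assms(2) by blast
  have "finite u" using u(1) by (simp add: boundary_def)
  then have "u \<noteq> Z" using assms(1) by blast
  then show thesis using that u initial_seg_trans[OF u(2) init] by (simp add: proper_initial_seg_def)
qed

lemma empty_not_boundary: "{} \<notin> B"
  using empty_mem by (simp add: boundary_def)

lemma base_boundary: "base B = X"
proof -
  have "X \<subseteq> \<Union>B"
  proof
    fix x assume x: "x \<in> X"
    \<comment> \<open>As \<open>x\<close> is the least element of \<open>?Z\<close>, every nonempty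
      initial segment of \<open>?Z\<close> contains it.\<close>
    let ?Z = "{y \<in> X. x \<le> y}"
    have "X \<subseteq> ?Z \<union> {..<x}" by auto
    then have "infinite ?Z"
      using infinite_X by (meson finite_UnI finite_lessThan finite_subset)
    then obtain u where u: "u \<in> B" "proper_initial_seg u ?Z" using boundary_bar by blast
    then obtain y where "y \<in> u" using empty_not_boundary by (metis all_not_in_conv)
    then have "x \<in> u"
      using u(2) x unfolding proper_initial_seg_def initial_seg_def
      by (cases "x = y") auto
    then show "x \<in> \<Union>B" using u(1) by blast
  qed
  moreover have "\<Union>B \<subseteq> X" by (auto simp: boundary_def)
  moreover have "B \<noteq> {{}}" using empty_not_boundary by blast
  ultimately show ?thesis by (auto simp: base_def)
qed

lemma front_boundary: "front B"
proof -
  have "\<not> proper_initial_seg s t" if "s \<in> B" "t \<in> B" for s t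
    using that by (auto simp: boundary_def)
  moreover have "finite s" if "s \<in> B" for s using that by (simp add: boundary_def)
  ultimately show ?thesis
    using infinite_X boundary_bar unfolding front_def base_boundary by metis
qed

text \<open>If smoothness fails for \<open>s\<close> and \<open>t\<close>, the first
  \<open>card s\<close> entries of \<open>t\<close> form a proper initial segment, hence a member of
  \<open>S\<close>, and lie entrywise at or below those of \<open>s\<close>. So they dominate
  \<open>s\<close>, which puts \<open>s\<close> into \<open>S\<close>.\<close>

lemma smooth_boundary: "smooth B"
  unfolding smooth_def
proof (intro ballI impI, rule ccontr)
  fix s t assume st: "s \<in> B" "t \<in> B" "card s < card t"
  let ?s = "(!) (sorted_list_of_set s)" and ?t = "(!) (sorted_list_of_set t)"
  assume "\<not> (\<exists>i<card s. ?s i < ?t i)"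
  then have le: "?t i \<le> ?s i" if "i < card s" for i using that by (meson not_less)
  have fin: "finite s" "finite t" using st by (auto simp: boundary_def)
  have s: "s = ?s ` {..<card s}" and t: "t = ?t ` {..<card t}"
    using set_conv_nth[of "sorted_list_of_set s"] set_conv_nth[of "sorted_list_of_set t"] fin
    by (auto simp: image_def)
  have inj_t: "inj_on ?t {..<card t}" by (auto intro: inj_on_nth)
  have mono_t: "i < j" if "?t i < ?t j" "i < card t" "j < card t" for i j
  proof (rule ccontr)
    assume "\<not> i < j"
    then have "?t j \<le> ?t i" using that by (intro sorted_nth_mono) auto
    then show False using that by simp
  qed
  let ?u = "?t ` {..<card s}"
  have sub: "?u \<subseteq> t" using st(3) t by fastforce
  have "initial_seg ?u t"
    unfolding initial_seg_def
  proof (intro conjI sub ballI impI)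
    fix x y assume "x \<in> ?u" "y \<in> t" "y < x"
    then obtain i j where "x = ?t i" "i < card s" "y = ?t j" "j < card t" using t by blast
    then show "y \<in> ?u" using mono_t[of j i] \<open>y < x\<close> st(3) by auto
  qed
  moreover have "card ?u = card s"
    using card_image[OF inj_on_subset[OF inj_t]] st(3) by auto
  then have "?u \<noteq> t" using st(3) by auto
  ultimately have "?u \<in> S" using st(2) by (simp add: boundary_def proper_initial_seg_def)
  moreover have "dominated s ?u"
    unfolding dominated_def
  proof
    fix m
    \<comment> \<open>The indices of the entries of \<open>s\<close> below \<open>m\<close>; the
      entries of \<open>t\<close> at these indices are below \<open>m\<close> too.\<close>
    let ?I = "{i. i < card s \<and> ?s i < m}"
    have "s \<inter> {..<m} = ?s ` ?I" using s by auto
    then have "card (s \<inter> {..<m}) \<le> card ?I" by (simp add: card_image_le)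
    also have "\<dots> = card (?t ` ?I)"
      using st(3) by (intro card_image[symmetric] inj_on_subset[OF inj_t]) auto
    also have "\<dots> \<le> card (?u \<inter> {..<m})"
    proof (rule card_mono)
      show "?t ` ?I \<subseteq> ?u \<inter> {..<m}"
      proof
        fix x assume "x \<in> ?t ` ?I"
        then obtain i where "x = ?t i" "i < card s" "?s i < m" by blast
        then show "x \<in> ?u \<inter> {..<m}" using le[of i] by auto
      qed
    qed simp
    finally show "card (s \<inter> {..<m}) \<le> card (?u \<inter> {..<m})" .
  qed
  ultimately have "s \<in> S" by (rule dominated_mem)
  then show False using boundaryD(3)[OF st(1)] by simp
qed

text \<open>A proper subset \<open>s\<close> of \<open>t\<close> is dominated by \<open>t\<close>
  without its maximum: up to the maximum by inclusion, beyond it because \<open>s\<close> has fewer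
  entries than \<open>t\<close>. As that set belongs to \<open>S\<close>, so would
  \<open>s\<close>.\<close>

lemma barrier_boundary: "barrier B"
proof -
  have "\<not> s \<subset> t" if "s \<in> B" "t \<in> B" for s t
  proof
    assume "s \<subset> t"
    have fin: "finite t" using that(2) by (simp add: boundary_def)
    have "t \<notin> S" "s \<notin> S" using that by (auto simp: boundary_def)
    obtain x where x: "x \<in> t" "x \<notin> s" using \<open>s \<subset> t\<close> by blast
    let ?u = "t - {Max t}"
    have ne: "t \<noteq> {}" using x by blast
    have "?u \<subseteq> t" "?u \<noteq> t" using Max_in[OF fin ne] by auto
    moreover have "y \<in> ?u" if "x \<in> ?u" "y \<in> t" "y < x" for x y
      using that Max_ge[OF fin, of x] by auto
    ultimately have "proper_initial_seg ?u t"
      unfolding proper_initial_seg_def initial_seg_def by blast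
    then have "?u \<in> S" using that(2) by (simp add: boundary_def)
    moreover have "dominated s ?u"
      unfolding dominated_def
    proof
      fix m
      show "card (s \<inter> {..<m}) \<le> card (?u \<inter> {..<m})"
      proof (cases "m \<le> Max t")
        case True
        then have "s \<inter> {..<m} \<subseteq> ?u \<inter> {..<m}" using \<open>s \<subset> t\<close> by auto
        then show ?thesis by (intro card_mono) auto
      next
        case False
        then have "?u \<subseteq> {..<m}" using Max_ge[OF fin] by fastforce
        then have "card (?u \<inter> {..<m}) = card t - 1"
          using Max_in[OF fin ne] fin by (simp add: Int_absorb2)
        moreover have "card (s \<inter> {..<m}) \<le> card s"
          using fin \<open>s \<subset> t\<close> finite_subset by (intro card_mono) auto
        ultimately show ?thesis using psubset_card_mono[OF fin \<open>s \<subset> t\<close>] by linarith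
      qed
    qed
    ultimately show False using dominated_mem \<open>s \<notin> S\<close> by blast
  qed
  then show ?thesis using front_boundary by (simp add: barrier_def)
qed

section \<open>The height of the boundary\<close>

lemma front_tree_boundary:
  "s \<in> front_tree B \<longleftrightarrow> finite s \<and> s \<subseteq> X \<and> (s \<in> S \<or> s \<in> B)"
proof
  assume s: "s \<in> front_tree B"
  then have fin: "finite s" "s \<subseteq> X" by (auto simp: front_tree_def base_boundary)
  moreover have "s \<in> B" if "s \<notin> S"
  proof -
    obtain u where u: "u \<in> B" "initial_seg u s" using boundary_initial[OF fin \<open>s \<notin> S\<close>] .
    moreover have "\<not> proper_initial_seg u s" using s u(1) by (simp add: front_tree_def)
    ultimately show ?thesis by (simp add: proper_initial_seg_def)
  qed
  ultimately show "finite s \<and> s \<subseteq> X \<and> (s \<in> S \<or> s \<in> B)" by blast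
next
  assume s: "finite s \<and> s \<subseteq> X \<and> (s \<in> S \<or> s \<in> B)"
  have "\<not> proper_initial_seg u s" if "u \<in> B" for u
  proof
    assume u: "proper_initial_seg u s"
    then have "u \<subseteq> s" by (simp add: proper_initial_seg_def initial_seg_def)
    then have "u \<in> S" using s u subset_mem boundaryD(4) by metis
    then show False using boundaryD(3)[OF that] by simp
  qed
  then show "s \<in> front_tree B" using s by (simp add: front_tree_def base_boundary)
qed

lemma insert_front_tree:
  assumes "s \<in> S" "finite s" "s \<subseteq> X" "n \<in> X" "precedes s {n}"
  shows "insert n s \<in> front_tree B"
proof -
  have "u \<notin> B" if u: "proper_initial_seg u (insert n s)" for u
  proof -
    have "n \<notin> u"
    proof
      assume "n \<in> u"
      then have "s \<subseteq> u" using u assms(5)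
        unfolding proper_initial_seg_def initial_seg_def precedes_def by blast
      then show False using u \<open>n \<in> u\<close> unfolding proper_initial_seg_def initial_seg_def by blast
    qed
    then have "u \<subseteq> s" using u unfolding proper_initial_seg_def initial_seg_def by blast
    then have "u \<in> S" by (rule subset_mem[OF assms(1)])
    then show ?thesis using boundaryD(3) by blast
  qed
  then show ?thesis using assms by (auto simp: front_tree_def base_boundary)
qed

lemma ht_at_less:
  assumes "s \<in> S" "finite s" "s \<subseteq> X" "n \<in> X" "precedes s {n}"
  shows "ht_at B (insert n s) < ht_at B s"
proof -
  have "s \<in> front_tree B" "s \<notin> B"
    using assms boundaryD(3)[of s] by (simp_all add: front_tree_boundary, blast)
  then have eq: "ht_at B s = ord_sup ((\<lambda>t. ord_succ (ht_at B t)) ` extensions B s)"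
    using ht_at_eq[OF front_boundary] by simp
  have "insert n s \<in> extensions B s"
    using insert_front_tree[OF assms] assms by (auto simp: extensions_def base_boundary)
  \<comment> \<open>\<open>ord_sup\<close> is known to be an upper bound for countable sets
    only.\<close>
  moreover have "countable (extensions B s)"
    by (rule countable_subset[of _ "range (\<lambda>n. s \<union> {n})"]) (auto simp: extensions_def)
  ultimately have "ord_succ (ht_at B (insert n s)) \<le> ht_at B s"
    unfolding eq by (intro ord_sup_upper) auto
  then show ?thesis by (simp add: ord_succ_le_iff)
qed

lemma ht_at_le:
  assumes "rank_le a (after s S)" "s \<in> front_tree B"
  shows "ht_at B s \<le> a"
  using assms
proof (induction a arbitrary: s rule: less_induct)
  case (less a)
  show ?case
  proof (cases "s \<in> B")
    case True
    then show ?thesis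
      using ht_at_eq[OF front_boundary less.prems(2)] zero_le_cord by simp
  next
    case False
    then have "s \<in> S" using less.prems(2) front_tree_boundary by blast
    \<comment> \<open>\<open>after s S\<close> contains \<open>{}\<close>, so its rank bound must
      come from the rule \<open>rank_le.step\<close>, which provides smaller bounds for all
      extensions.\<close>
    then have ne: "after s S \<noteq> {}" by (auto simp: after_def precedes_def intro: exI[of _ "{}"])
    have desc: "\<exists>b<a. rank_le b (after {n} (after s S))" for n
      using less.prems(1) ne by cases auto
    have "ht_at B s = ord_sup ((\<lambda>t. ord_succ (ht_at B t)) ` extensions B s)"
      using ht_at_eq[OF front_boundary less.prems(2)] False by simp
    also have "\<dots> \<le> a"
    proof (rule ord_sup_least)
      fix x assume "x \<in> (\<lambda>t. ord_succ (ht_at B t)) ` extensions B s"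
      then obtain n where x: "x = ord_succ (ht_at B (insert n s))" and n: "precedes s {n}"
        "insert n s \<in> front_tree B" by (auto simp: extensions_def)
      obtain b where b: "b < a" "rank_le b (after {n} (after s S))" using desc by blast
      then have "ht_at B (insert n s) \<le> b" using less.IH n by (simp add: after_after)
      then show "x \<le> a" using b(1) x by (simp add: ord_succ_le_iff)
    qed
    finally show ?thesis .
  qed
qed

text \<open>Each \<open>b < a\<close> has an index \<open>i\<close> in the enumeration of
  \<open>{..<a}\<close>. As \<open>X\<close> is infinite, it has an \<open>n\<close> above both
  \<open>s\<close> and \<open>i\<close>, and canonical sets for \<open>b\<close> placed after
  \<open>n\<close> are canonical for \<open>a\<close>. So the extension by \<open>n\<close> has
  height at least \<open>b\<close>.\<close>

lemma ht_at_ge: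
  assumes "s \<in> front_tree B" "\<And>t. canonical a t \<Longrightarrow> precedes s t \<Longrightarrow> s \<union> t \<in> S"
  shows "a \<le> ht_at B s"
  using assms
proof (induction a arbitrary: s rule: less_induct)
  case (less a)
  have s: "finite s" "s \<subseteq> X" using less.prems(1) by (simp_all add: front_tree_boundary)
  have "b < ht_at B s" if b: "b < a" for b
  proof -
    have pos: "0 < a" by (rule le_less_trans[OF zero_le_cord b])
    then have "s \<in> S" using less.prems(2)[of "{}"] canonical.empty by (simp add: precedes_def)
    obtain i where i: "b = from_nat_into {..<a} i"
      using from_nat_into_surj[OF countable_lessThan_cord, of b a] b by auto
    obtain m where m: "\<forall>x\<in>s. x < m" using s(1) finite_nat_set_iff_bounded by blast
    obtain n where n: "n \<in> X" "max m i < n" using infinite_X infinite_nat_iff_unbounded by blast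
    have prec: "precedes s {n}" using m n(2) by (force simp: precedes_def)
    have "b \<le> ht_at B (insert n s)"
    proof (rule less.IH[OF b insert_front_tree[OF \<open>s \<in> S\<close> s n(1) prec]])
      fix t assume t: "canonical b t" "precedes (insert n s) t"
      then have "canonical a (insert n t)"
        using pos i n(2) by (intro canonical.insert[of a i]) (auto simp: precedes_def)
      moreover have "precedes s (insert n t)" using t(2) prec by (auto simp: precedes_def)
      ultimately show "insert n s \<union> t \<in> S" using less.prems(2)[of "insert n t"] by simp
    qed
    then show ?thesis using ht_at_less[OF \<open>s \<in> S\<close> s n(1) prec] by simp
  qed
  then show ?case using leI less_irrefl by blast
qed

lemma ht_boundary:
  assumes "rank_le a S" "\<And>t. canonical a t \<Longrightarrow> t \<in> S"
  shows "ht B = a"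
proof -
  have "{} \<in> front_tree B" using empty_mem by (simp add: front_tree_boundary)
  then show ?thesis
    unfolding ht_def using assms
    by (intro antisym ht_at_le ht_at_ge) (simp_all add: after_empty)
qed

text \<open>The Cantor normal form has a single term, and summing with the degenerate front returns
  \<open>B\<close>.\<close>

lemma SD_barrier_boundary:
  assumes "ht B = omega_pow a"
  shows "SD_barrier B"
proof -
  have "B \<oplus>\<^sub>f {{}} = B" by (auto simp: front_sum_def precedes_def)
  then have "decomposable B"
    unfolding decomposable_def using assms barrier_boundary smooth_boundary
    by (intro exI[of _ "[a]"] exI[of _ "[B]"]) (simp add: add_zero_cord)
  then show ?thesis using barrier_boundary smooth_boundary by (simp add: SD_barrier_def)
qed

end

section \<open>Construction of the barrier\<close>

theorem theorem4p4:
  fixes k :: nat and A C :: "nat set set"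
  assumes "SD_barrier A" and "SD_barrier C"
    and "final_seg (base A) (base C)"
  shows "\<exists>B. SD_barrier B \<and> base B = base A \<and> arrows B A C k"
proof -
  have A: "front A" and C: "front C"
    using assms by (auto simp: SD_barrier_def barrier_def)
  have sub: "base A \<subseteq> base C" using assms(3) by (auto simp: final_seg_def)
  have inf: "infinite (base A)" using A by (auto simp: front_def base_def split: if_splits)
  define Bad where "Bad = {s. s \<subseteq> base A \<and> \<not> good A C k s}"
  \<comment> \<open>The closure may leave \<open>base A\<close>, so its bar is established along all
    increasing sequences of naturals.\<close>
  define T where "T = {t. \<exists>s\<in>Bad. dominated t s}"
  have T_mem: "t \<in> T" if "s \<in> T" "dominated t s" for s t
    using that dominated_trans unfolding T_def by blast
  have T_bar: "\<exists>i. f ` {..<i} \<notin> T" if f: "strict_mono f" for f :: "nat \<Rightarrow> nat"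
  proof -
    have "\<exists>m. \<forall>s\<in>Bad. \<not> dominated (range f \<inter> {..<m}) s"
    proof (rule spread_bar[of Bad "base A"])
      show "t \<in> Bad" if "s \<in> Bad" "t \<subseteq> s" for s t
        using that good_mono[of A C k t s] by (simp add: Bad_def) (meson subset_trans)
      show "s \<subseteq> base A" if "s \<in> Bad" for s using that by (simp add: Bad_def)
      show "\<exists>m. Y \<inter> {..<m} \<notin> Bad" if "infinite Y" "Y \<subseteq> base A" for Y
        using ex_good_initial[OF A C sub that, of k] by (auto simp: Bad_def)
      show "infinite (range f)" using f by (simp add: range_inj_infinite strict_mono_imp_inj_on)
    qed
    then obtain m where m: "\<forall>s\<in>Bad. \<not> dominated (range f \<inter> {..<m}) s" by (rule exE)
    have "initial_seg (range f \<inter> {..<m}) (range f)" "finite (range f \<inter> {..<m})"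
      by (auto simp: initial_seg_def)
    then obtain i where i: "range f \<inter> {..<m} = f ` {..<i}"
      using initial_seg_range[OF f] by metis
    show ?thesis using m unfolding i by (intro exI[of _ i]) (simp add: T_def)
  qed
  have "\<exists>a. rank_le a T"
    by (rule ex_rank_le[OF _ T_bar]) (rule T_mem[OF _ subset_dominated])
  then obtain a where a: "rank_le a T" by (rule exE)
  \<comment> \<open>Both parts have rank at most \<open>omega_pow a\<close>, and the canonical part
    forces this height exactly. Sets outside \<open>S\<close> are in particular outside
    \<open>T\<close>, so enlarging \<open>T\<close> preserves goodness on the boundary.\<close>
  define S where "S = T \<union> Collect (canonical (omega_pow a))"
  have rank: "rank_le (omega_pow a) S"
    unfolding S_def by (intro rank_le_Un rank_le_mono[OF a] le_omega_pow rank_le_canonical)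
  have "0 < omega_pow a"
    using one_le_omega_pow less_ord_succ[of 0] by (metis one_cord_def less_le_trans)
  interpret spread_family "base A" S
  proof
    show "t \<in> S" if "s \<in> S" "dominated t s" for s t
      using that T_mem canonical_dominated unfolding S_def by blast
    \<comment> \<open>\<open>T\<close> is empty if there are no bad sets; the canonical family
      contributes \<open>{}\<close> in any case.\<close>
    show "{} \<in> S" using \<open>0 < omega_pow a\<close> by (simp add: S_def canonical.empty)
  qed (use inf rank_le_bar[OF rank] in simp_all)
  have "ht B = omega_pow a" using rank by (rule ht_boundary) (simp add: S_def)
  then have "SD_barrier B" by (rule SD_barrier_boundary)
  moreover have "arrows B A C k"
    unfolding arrows_iff_good
  proof
    fix s assume "s \<in> singletons (base B) \<oplus>\<^sub>f B"
    then obtain b where b: "b \<in> B" "b \<subseteq> s" unfolding front_sum_def by blast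
    then have "b \<subseteq> base A" "b \<notin> T" using boundaryD(2,3)[OF b(1)] by (simp_all add: S_def)
    \<comment> \<open>Since \<open>b\<close> dominates itself, a bad \<open>b\<close> would belong
      to \<open>T\<close>. Goodness then passes to the larger set \<open>s\<close>.\<close>
    then have "good A C k b" using subset_dominated[of b b] unfolding T_def Bad_def by blast
    then show "good A C k s" using b(2) by (rule good_mono)
  qed
  ultimately show ?thesis using base_boundary by blast
qed

end
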